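(* Let $G$ be a non-compact semi-simple Lie group equipped with its standard semi-Riemannian metric, let $U$ be its compact dual equipped with its standard Riemannian metric, and let $W$ be an open subset of $G$. Let $\mathcal{E}$ be a family of real analytic maps $\phi:W\to\mathbb{C}$ and let $\mathcal{E}^*$ be the dual family consisting of the maps $\phi^*:W^*\to\mathbb{C}$, $\phi\in\mathcal{E}$, where $\phi^*$ is the restriction to $W^*=U\cap W^{\mathbb{C}}$ of the unique holomorphic extension $\phi^{\mathbb{C}}:W^{\mathbb{C}}\to\mathbb{C}$ of $\phi$ to some open subset $W^{\mathbb{C}}$ of the complexification $G^{\mathbb{C}}$ of $G$. Then $\mathcal{E}^*$ is an eigenfamily (on $W^*\subset U$) if and only if $\mathcal{E}$ is an eigenfamily (on $W\subset G$).
   Context: Setting: let $\mathfrak{g}=\mathfrak{k}+\mathfrak{p}$ be a Cartan decomposition of the Lie algebra of $G$, where $\mathfrak{k}$ is the Lie algebra of a maximal compact subgroup $K$. The complexification $G^{\mathbb{C}}$ has Lie algebra $\mathfrak{g}^{\mathbb{C}}=\mathfrak{g}\otimes\mathbb{C}$, and the compact dual $U\subset G^{\mathbb{C}}$ has Lie algebra $\mathfrak{u}=\mathfrak{k}+i\mathfrak{p}$. The metric on $G$ is a left-invariant semi-Riemannian metric for which $\mathfrak{k}$ and $\mathfrak{p}$ are orthogonal, negative definite on $\mathfrak{k}$ and positive definite on $\mathfrak{p}$ (for matrix groups it is induced by $h(Z,W)=\operatorname{Re}\operatorname{trace}(ZW)$). The metric on $U$ is the left-invariant Riemannian metric dual to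 it: if $Y_1,\dots,Y_m\in\mathfrak{k}$ and $X_1,\dots,X_n\in\mathfrak{p}$ are orthonormal bases of $\mathfrak{k}$ and $\mathfrak{p}$ for the metric on $G$ (with sign $-1$ on $\mathfrak{k}$), then $Y_1,\dots,Y_m,iX_1,\dots,iX_n$ is an orthonormal basis of $\mathfrak{u}$ (for matrix groups it is induced by $\operatorname{Re}\operatorname{trace}(ZW^* )$). For complex valued functions, with left-invariant vector fields acting as derivations, on $G$ one has $$\tau(\phi)=-\sum_{k=1}^m Y_k^2(\phi)+\sum_{k=1}^n X_k^2(\phi),\qquad \kappa(\phi,\psi)=-\sum_{k=1}^m Y_k(\phi)Y_k(\psi)+\sum_{k=1}^n X_k(\phi)X_k(\psi),$$ and on $U$ $$\tau(\phi)=\sum_{k=1}^m Y_k^2(\phi)+\sum_{k=1}^n (iX_k)^2(\phi),\qquad \kappa(\phi,\psi)=\sum_{k=1}^m Y_k(\phi)Y_k(\psi)+\sum_{k=1}^n (iX_k)(\phi)(iX_k)(\psi).$$ A set $\mathcal{E}$ of complex valued functions on a semi-Riemannian manifold is an eigenfamily if there exist $\lambda,\mu\in\mathbb{C}$ such that $\tau(\phi)=\lambda\phi$ and $\kappa(\phi,\psi)=\mu\,\phi\psi$ for all $\phi,\psi\in\mathcal{E}$.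
   Formalization: It is additionally assumed that every connected component of W^C meets U (for connected W^C: W* is non-empty); without this the "only if" direction fails, since for empty W* the dual family E* is vacuously an eigenfamily whatever E is. *)

theory Defs
  imports "HOL-Analysis.Analysis" "HOL-Algebra.Coset"
begin

section \<open>Complex Lie groups\<close>

text \<open>
  A chart is a pair of an open domain and a map to \<open>\<complex>\<^sup>d\<close>. The group is carried by a whole type
  with its topology. The distinguished chart around the identity identifies the tangent
  space at the identity with \<open>\<complex>\<^sup>d\<close>.
\<close>

record ('g, 'd) lie_data = "'g monoid" +
  charts :: "('g set \<times> ('g \<Rightarrow> complex ^ 'd::finite)) set"
  chart0 :: "'g set \<times> ('g \<Rightarrow> complex ^ 'd::finite)"

text \<open>
  Complex differentiability between complex vector spaces whose scalar multiplications
  \<open>s\<close> and \<open>t\<close> are passed explicitly (there is no type class for complex vector spaces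
  that covers \<open>\<complex>\<close>, \<open>\<complex>\<^sup>d\<close> and products).
\<close>

definition hol_on ::
  "(complex \<Rightarrow> 'a \<Rightarrow> 'a) \<Rightarrow> (complex \<Rightarrow> 'b \<Rightarrow> 'b) \<Rightarrow>
    ('a::real_normed_vector \<Rightarrow> 'b::real_normed_vector) \<Rightarrow> 'a set \<Rightarrow> bool" where
  "hol_on s t f S \<longleftrightarrow>
    (\<forall>z\<in>S. \<exists>f'. (f has_derivative f') (at z) \<and> (\<forall>c v. f' (s c v) = t c (f' v)))"

definition scale_pair ::
  "complex \<Rightarrow> (complex ^ 'd) \<times> (complex ^ 'd) \<Rightarrow> (complex ^ 'd) \<times> (complex ^ 'd)" where
  "scale_pair c p = (c *s fst p, c *s snd p)"

definition complex_atlas ::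
  "('g::{t2_space, second_countable_topology} set \<times> ('g \<Rightarrow> complex ^ 'd)) set \<Rightarrow> bool" where
  "complex_atlas A \<longleftrightarrow>
    (\<forall>(D, \<xi>)\<in>A. open D \<and> open (\<xi> ` D) \<and> homeomorphism D (\<xi> ` D) \<xi> (inv_into D \<xi>)) \<and>
    \<Union>(fst ` A) = UNIV \<and>
    (\<forall>(D, \<xi>)\<in>A. \<forall>(D', \<xi>')\<in>A.
       hol_on (*s) (*s) (\<xi>' \<circ> inv_into D \<xi>) (\<xi> ` (D \<inter> D')))"

definition complex_lie_group ::
  "('g::{t2_space, second_countable_topology}, 'd::finite) lie_data \<Rightarrow> bool" where
  "complex_lie_group L \<longleftrightarrow>
    group L \<and> carrier L = UNIV \<and>
    complex_atlas (charts L) \<and> chart0 L \<in> charts L \<and> \<one>\<^bsub>L\<^esub> \<in> fst (chart0 L) \<and>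
    continuous_on UNIV (\<lambda>(x, y). x \<otimes>\<^bsub>L\<^esub> y) \<and>
    continuous_on UNIV (\<lambda>x. inv\<^bsub>L\<^esub> x) \<and>
    (\<forall>(D1, \<xi>1)\<in>charts L. \<forall>(D2, \<xi>2)\<in>charts L. \<forall>(D3, \<xi>3)\<in>charts L.
       hol_on scale_pair (*s)
         (\<lambda>(z, w). \<xi>3 (inv_into D1 \<xi>1 z \<otimes>\<^bsub>L\<^esub> inv_into D2 \<xi>2 w))
         {(\<xi>1 x, \<xi>2 y) | x y. x \<in> D1 \<and> y \<in> D2 \<and> x \<otimes>\<^bsub>L\<^esub> y \<in> D3}) \<and>
    (\<forall>(D1, \<xi>1)\<in>charts L. \<forall>(D2, \<xi>2)\<in>charts L.
       hol_on (*s) (*s)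
         (\<lambda>z. \<xi>2 (inv\<^bsub>L\<^esub> (inv_into D1 \<xi>1 z)))
         {\<xi>1 x | x. x \<in> D1 \<and> inv\<^bsub>L\<^esub> x \<in> D2})"

definition holomorphic_fun ::
  "('g::{t2_space, second_countable_topology}, 'd::finite) lie_data \<Rightarrow>
    ('g \<Rightarrow> complex) \<Rightarrow> 'g set \<Rightarrow> bool" where
  "holomorphic_fun L f S \<longleftrightarrow>
    (\<forall>(D, \<xi>)\<in>charts L. hol_on (*s) (*) (f \<circ> inv_into D \<xi>) (\<xi> ` (D \<inter> S)))"


section \<open>Lie algebras of closed subgroups and left-invariant vector fields\<close>

text \<open>
  A closed subgroup \<open>H\<close> is an embedded real Lie subgroup, and its Lie algebra is the space of
  velocities at the identity of \<open>C\<^sup>1\<close> curves in \<open>H\<close>, read in the distinguished chart. Only the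
  values of a curve near \<open>0\<close> matter.
\<close>

definition curve_in ::
  "('g::{t2_space, second_countable_topology}, 'd::finite) lie_data \<Rightarrow> 'g set \<Rightarrow>
    complex ^ 'd \<Rightarrow> (real \<Rightarrow> 'g) \<Rightarrow> bool" where
  "curve_in L H v c \<longleftrightarrow>
    c 0 = \<one>\<^bsub>L\<^esub> \<and>
    (\<exists>\<delta>>0. (\<forall>t\<in>{-\<delta><..<\<delta>}. c t \<in> H \<inter> fst (chart0 L)) \<and>
           (snd (chart0 L) \<circ> c) C1_differentiable_on {-\<delta><..<\<delta>}) \<and>
    ((snd (chart0 L) \<circ> c) has_vector_derivative v) (at 0)"

definition lie_algebra ::
  "('g::{t2_space, second_countable_topology}, 'd::finite) lie_data \<Rightarrow> 'g set \<Rightarrow>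
    (complex ^ 'd) set" where
  "lie_algebra L H = {v. \<exists>c. curve_in L H v c}"

text \<open>
  The left-invariant vector field on \<open>H\<close> generated by \<open>v\<close>, acting on a function on an open
  subset of \<open>H\<close>: the derivative at \<open>t = 0\<close> of \<open>f (g \<otimes> c t)\<close> for curves \<open>c\<close> in \<open>H\<close> with
  velocity \<open>v\<close> at the identity. For \<open>C\<^sup>1\<close> functions the choice of \<open>c\<close> is irrelevant. With
  \<open>H = UNIV\<close> this is the action of the whole tangent space of the complex group.
\<close>

definition lie_deriv ::
  "('g::{t2_space, second_countable_topology}, 'd::finite) lie_data \<Rightarrow> 'g set \<Rightarrow>
    complex ^ 'd \<Rightarrow> ('g \<Rightarrow> 'a::real_normed_vector) \<Rightarrow> 'g \<Rightarrow> 'a" where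
  "lie_deriv L H v f g =
    (THE D. \<forall>c. curve_in L H v c \<longrightarrow>
       ((\<lambda>t. f (g \<otimes>\<^bsub>L\<^esub> c t)) has_vector_derivative D) (at 0))"

text \<open>
  The bracket is the commutator of left-invariant vector fields; its coordinates are obtained by
  applying the commutator to the coordinate functions of the chart at the identity.
\<close>

definition lie_bracket ::
  "('g::{t2_space, second_countable_topology}, 'd::finite) lie_data \<Rightarrow>
    complex ^ 'd \<Rightarrow> complex ^ 'd \<Rightarrow> complex ^ 'd" where
  "lie_bracket L v w =
    lie_deriv L UNIV v (lie_deriv L UNIV w (snd (chart0 L))) \<one>\<^bsub>L\<^esub> -
    lie_deriv L UNIV w (lie_deriv L UNIV v (snd (chart0 L))) \<one>\<^bsub>L\<^esub>"

definition trace_on :: "'a::real_vector set \<Rightarrow> ('a \<Rightarrow> 'a) \<Rightarrow> real" where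
  "trace_on V T =
    (let B = (SOME B. independent B \<and> span B = V) in \<Sum>b\<in>B. representation B (T b) b)"

definition killing_form ::
  "('g::{t2_space, second_countable_topology}, 'd::finite) lie_data \<Rightarrow> (complex ^ 'd) set \<Rightarrow>
    complex ^ 'd \<Rightarrow> complex ^ 'd \<Rightarrow> real" where
  "killing_form L \<gg> x y = trace_on \<gg> (lie_bracket L x \<circ> lie_bracket L y)"

definition semisimple_lie_algebra ::
  "('g::{t2_space, second_countable_topology}, 'd::finite) lie_data \<Rightarrow> (complex ^ 'd) set \<Rightarrow> bool" where
  "semisimple_lie_algebra L \<gg> \<longleftrightarrow>
    (\<forall>x\<in>\<gg>. (\<forall>y\<in>\<gg>. killing_form L \<gg> x y = 0) \<longrightarrow> x = 0)"


section \<open>Non-compact semisimple groups, complexification, compact dual\<close>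

text \<open>
  \<open>L\<close> is a complexification of its closed subgroup \<open>G\<close>: the Lie algebra of \<open>L\<close>, which is all
  of \<open>\<complex>\<^sup>d\<close>, is \<open>\<gg> \<oplus> \<i>\<gg>\<close>, i.e. \<open>\<gg> \<otimes> \<complex>\<close>.
\<close>

definition complexification_of ::
  "('g::{t2_space, second_countable_topology}, 'd::finite) lie_data \<Rightarrow> 'g set \<Rightarrow> bool" where
  "complexification_of L G \<longleftrightarrow>
    complex_lie_group L \<and> subgroup G L \<and> closed G \<and>
    (\<forall>z. \<exists>!(x, y). x \<in> lie_algebra L G \<and> y \<in> lie_algebra L G \<and> z = x + \<i> *s y)"

definition noncompact_semisimple ::
  "('g::{t2_space, second_countable_topology}, 'd::finite) lie_data \<Rightarrow> 'g set \<Rightarrow> bool" where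
  "noncompact_semisimple L G \<longleftrightarrow>
    subgroup G L \<and> \<not> compact G \<and> semisimple_lie_algebra L (lie_algebra L G)"

definition maximal_compact_subgroup ::
  "('g::{t2_space, second_countable_topology}, 'd::finite) lie_data \<Rightarrow> 'g set \<Rightarrow> 'g set \<Rightarrow> bool" where
  "maximal_compact_subgroup L G K \<longleftrightarrow>
    subgroup K L \<and> K \<subseteq> G \<and> compact K \<and>
    (\<forall>K'. subgroup K' L \<and> K' \<subseteq> G \<and> compact K' \<and> K \<subseteq> K' \<longrightarrow> K' = K)"

definition cartan_decomposition ::
  "('g::{t2_space, second_countable_topology}, 'd::finite) lie_data \<Rightarrow>
    (complex ^ 'd) set \<Rightarrow> (complex ^ 'd) set \<Rightarrow> (complex ^ 'd) set \<Rightarrow> bool" where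
  "cartan_decomposition L \<gg> \<kk> \<pp> \<longleftrightarrow>
    subspace \<kk> \<and> subspace \<pp> \<and> \<kk> \<inter> \<pp> = {0} \<and> \<gg> = {y + x | y x. y \<in> \<kk> \<and> x \<in> \<pp>} \<and>
    (\<forall>y\<in>\<kk>. \<forall>y'\<in>\<kk>. lie_bracket L y y' \<in> \<kk>) \<and>
    (\<forall>y\<in>\<kk>. \<forall>x\<in>\<pp>. lie_bracket L y x \<in> \<pp>) \<and>
    (\<forall>x\<in>\<pp>. \<forall>x'\<in>\<pp>. lie_bracket L x x' \<in> \<kk>) \<and>
    (\<forall>y\<in>\<kk>. y \<noteq> 0 \<longrightarrow> killing_form L \<gg> y y < 0) \<and>
    (\<forall>x\<in>\<pp>. x \<noteq> 0 \<longrightarrow> killing_form L \<gg> x x > 0)"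

definition compact_dual ::
  "('g::{t2_space, second_countable_topology}, 'd::finite) lie_data \<Rightarrow>
    (complex ^ 'd) set \<Rightarrow> (complex ^ 'd) set \<Rightarrow> 'g set \<Rightarrow> bool" where
  "compact_dual L \<kk> \<pp> U \<longleftrightarrow>
    subgroup U L \<and> compact U \<and> lie_algebra L U = {y + \<i> *s x | y x. y \<in> \<kk> \<and> x \<in> \<pp>}"


section \<open>Left-invariant metrics\<close>

text \<open>A left-invariant metric is given by a symmetric bilinear form on the Lie algebra.\<close>

definition symmetric_bilinear_on :: "'a::real_vector set \<Rightarrow> ('a \<Rightarrow> 'a \<Rightarrow> real) \<Rightarrow> bool" where
  "symmetric_bilinear_on V h \<longleftrightarrow>
    (\<forall>x\<in>V. \<forall>y\<in>V. h x y = h y x) \<and>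
    (\<forall>x\<in>V. \<forall>y\<in>V. \<forall>z\<in>V. h (x + y) z = h x z + h y z) \<and>
    (\<forall>x\<in>V. \<forall>z\<in>V. \<forall>r. h (r *\<^sub>R x) z = r * h x z)"

definition orthonormal_basis ::
  "('a::real_vector \<Rightarrow> 'a \<Rightarrow> real) \<Rightarrow> 'a set \<Rightarrow> 'a set \<Rightarrow> bool" where
  "orthonormal_basis h V B \<longleftrightarrow>
    independent B \<and> span B = V \<and>
    (\<forall>x\<in>B. \<bar>h x x\<bar> = 1) \<and> (\<forall>x\<in>B. \<forall>y\<in>B. x \<noteq> y \<longrightarrow> h x y = 0)"

definition standard_metric ::
  "'a::real_vector set \<Rightarrow> 'a set \<Rightarrow> 'a set \<Rightarrow> ('a \<Rightarrow> 'a \<Rightarrow> real) \<Rightarrow> bool" where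
  "standard_metric \<gg> \<kk> \<pp> h \<longleftrightarrow>
    symmetric_bilinear_on \<gg> h \<and>
    (\<forall>y\<in>\<kk>. \<forall>x\<in>\<pp>. h y x = 0) \<and>
    (\<forall>y\<in>\<kk>. y \<noteq> 0 \<longrightarrow> h y y < 0) \<and>
    (\<forall>x\<in>\<pp>. x \<noteq> 0 \<longrightarrow> h x x > 0)"

definition dual_metric ::
  "(complex ^ 'd) set \<Rightarrow> (complex ^ 'd) set \<Rightarrow> (complex ^ 'd) set \<Rightarrow>
    (complex ^ 'd \<Rightarrow> complex ^ 'd \<Rightarrow> real) \<Rightarrow>
    (complex ^ 'd \<Rightarrow> complex ^ 'd \<Rightarrow> real) \<Rightarrow> bool" where
  "dual_metric \<uu> \<kk> \<pp> h h' \<longleftrightarrow>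
    symmetric_bilinear_on \<uu> h' \<and> (\<forall>z\<in>\<uu>. z \<noteq> 0 \<longrightarrow> h' z z > 0) \<and>
    (\<forall>BK BP. orthonormal_basis h \<kk> BK \<and> orthonormal_basis h \<pp> BP \<longrightarrow>
       orthonormal_basis h' \<uu> (BK \<union> (\<lambda>x. \<i> *s x) ` BP))"


section \<open>Eigenfamilies\<close>

text \<open>
  For a left-invariant metric on a unimodular group (in particular a semisimple or a compact one)
  the first-order part of the Laplace--Beltrami operator, \<open>\<Sum> \<epsilon>\<^sub>e \<nabla>\<^sub>e e\<close>, vanishes, so that the
  operator is \<open>\<Sum> \<epsilon>\<^sub>e e\<^sup>2\<close> over any orthonormal basis of the Lie algebra, with \<open>\<epsilon>\<^sub>e = h e e\<close>. Both
  sums below do not depend on the basis chosen.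
\<close>

definition some_orthonormal_basis ::
  "('a::real_vector \<Rightarrow> 'a \<Rightarrow> real) \<Rightarrow> 'a set \<Rightarrow> 'a set" where
  "some_orthonormal_basis h V = (SOME B. orthonormal_basis h V B)"

definition tension ::
  "('g::{t2_space, second_countable_topology}, 'd::finite) lie_data \<Rightarrow> 'g set \<Rightarrow>
    (complex ^ 'd \<Rightarrow> complex ^ 'd \<Rightarrow> real) \<Rightarrow> ('g \<Rightarrow> complex) \<Rightarrow> 'g \<Rightarrow> complex" where
  "tension L H h \<phi> g =
    (\<Sum>e\<in>some_orthonormal_basis h (lie_algebra L H).
       of_real (h e e) * lie_deriv L H e (lie_deriv L H e \<phi>) g)"

definition conformality ::
  "('g::{t2_space, second_countable_topology}, 'd::finite) lie_data \<Rightarrow> 'g set \<Rightarrow>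
    (complex ^ 'd \<Rightarrow> complex ^ 'd \<Rightarrow> real) \<Rightarrow>
    ('g \<Rightarrow> complex) \<Rightarrow> ('g \<Rightarrow> complex) \<Rightarrow> 'g \<Rightarrow> complex" where
  "conformality L H h \<phi> \<psi> g =
    (\<Sum>e\<in>some_orthonormal_basis h (lie_algebra L H).
       of_real (h e e) * lie_deriv L H e \<phi> g * lie_deriv L H e \<psi> g)"

definition eigenfamily ::
  "('g::{t2_space, second_countable_topology}, 'd::finite) lie_data \<Rightarrow> 'g set \<Rightarrow>
    (complex ^ 'd \<Rightarrow> complex ^ 'd \<Rightarrow> real) \<Rightarrow> 'g set \<Rightarrow> ('g \<Rightarrow> complex) set \<Rightarrow> bool" where
  "eigenfamily L H h W \<E> \<longleftrightarrow>
    (\<exists>lam \<mu>. \<forall>\<phi>\<in>\<E>. \<forall>\<psi>\<in>\<E>. \<forall>g\<in>W.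
       tension L H h \<phi> g = lam * \<phi> g \<and> conformality L H h \<phi> \<psi> g = \<mu> * \<phi> g * \<psi> g)"


section \<open>Real analytic maps and dual maps\<close>

text \<open>
  Real analyticity at a point: the function is the sum of a power series in the real coordinates,
  indexed by multi-indices \<open>\<alpha>\<close> on the canonical basis.
\<close>

definition real_analytic_at :: "('a::euclidean_space \<Rightarrow> complex) \<Rightarrow> 'a \<Rightarrow> bool" where
  "real_analytic_at F z \<longleftrightarrow>
    (\<exists>a. \<exists>r>0. \<forall>x. norm x < r \<longrightarrow>
       ((\<lambda>\<alpha>. a \<alpha> * of_real (\<Prod>b\<in>Basis. (x \<bullet> b) ^ \<alpha> b)) has_sum F (z + x))
         (Basis \<rightarrow>\<^sub>E (UNIV :: nat set)))"

text \<open>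
  A function on an open subset \<open>W\<close> of an embedded real analytic submanifold is real analytic if it
  is locally the restriction of a real analytic function on the ambient manifold.
\<close>

definition real_analytic_fun ::
  "('g::{t2_space, second_countable_topology}, 'd::finite) lie_data \<Rightarrow> 'g set \<Rightarrow>
    ('g \<Rightarrow> complex) \<Rightarrow> bool" where
  "real_analytic_fun L W \<phi> \<longleftrightarrow>
    (\<forall>g\<in>W. \<exists>N F. open N \<and> g \<in> N \<and> (\<forall>x\<in>W \<inter> N. F x = \<phi> x) \<and>
       (\<forall>(D, \<xi>)\<in>charts L. \<forall>x\<in>D \<inter> N. real_analytic_at (F \<circ> inv_into D \<xi>) (\<xi> x)))"

text \<open>Maps \<open>S \<rightarrow> \<complex>\<close> are identified with total functions that are undefined outside \<open>S\<close>.\<close>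

definition is_holomorphic_extension ::
  "('g::{t2_space, second_countable_topology}, 'd::finite) lie_data \<Rightarrow> 'g set \<Rightarrow> 'g set \<Rightarrow>
    ('g \<Rightarrow> complex) \<Rightarrow> ('g \<Rightarrow> complex) \<Rightarrow> bool" where
  "is_holomorphic_extension L W WC \<phi> \<psi> \<longleftrightarrow>
    \<psi> \<in> extensional WC \<and> holomorphic_fun L \<psi> WC \<and> (\<forall>g\<in>W. \<psi> g = \<phi> g)"

definition holomorphic_extension ::
  "('g::{t2_space, second_countable_topology}, 'd::finite) lie_data \<Rightarrow> 'g set \<Rightarrow> 'g set \<Rightarrow>
    ('g \<Rightarrow> complex) \<Rightarrow> 'g \<Rightarrow> complex" where
  "holomorphic_extension L W WC \<phi> = (THE \<psi>. is_holomorphic_extension L W WC \<phi> \<psi>)"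

definition dual_map ::
  "('g::{t2_space, second_countable_topology}, 'd::finite) lie_data \<Rightarrow> 'g set \<Rightarrow> 'g set \<Rightarrow>
    'g set \<Rightarrow> ('g \<Rightarrow> complex) \<Rightarrow> 'g \<Rightarrow> complex" where
  "dual_map L U W WC \<phi> = restrict (holomorphic_extension L W WC \<phi>) (U \<inter> WC)"

end

(*
  On a holomorphic function a left-invariant vector field v acts complex linearly in v.
  Hence on G and on U both operators are restrictions of sums over orthonormal bases of
  complex bilinear expressions in the holomorphic extensions; as u = k + ip, the sums for
  G and for U differ only by a sign, and the eigenvalues (lambda, mu) on one side become
  (-lambda, -mu) on the other. It remains to move a holomorphic equation on W^C between W
  and W^*. From W to W^C this is the uniqueness of the extension. From W^* to W^C one uses
  that u + iu is the whole Lie algebra: all iterated left-invariant derivatives of a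
  holomorphic function vanishing on W^* vanish there, and the set where all of them
  vanish is open and closed in W^C.
*)
theory Submission
  imports Defs "HOL-Complex_Analysis.Complex_Analysis"
begin

section \<open>Holomorphic maps on complex vector spaces\<close>

text \<open>Openness of that common zero set is the analytic core. \<open>hol_on\<close> grants only
  pointwise complex differentiability, so holomorphy of derivatives has to be earned: on complex
  lines Cauchy's formula writes a directional derivative as an integral of values of the function
  over one fixed circle, and one differentiates under the integral sign. Multivariate Taylor series
  are then bypassed. In a chart, a directional derivative is a combination of left-invariant ones
  with continuous coefficients (the Maurer-Cartan form). Along a complex line through a common zero
  the iterated left-invariant derivatives thus form an infinite family in which the derivative of
  each member is a finite combination of members. Integrating raises the order of vanishing of every
  member by one, so each is flat at the centre and, being holomorphic in one variable, is zero. A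
  second obstacle is the form of the definitions: Lie derivatives are given by curves and both
  operators by an arbitrarily chosen basis. The former are identified with derivatives of the
  extension, the latter are freed of the choice by a trace argument for indefinite forms.\<close>

definition complex_scaling :: "(complex \<Rightarrow> 'a \<Rightarrow> 'a::real_normed_vector) \<Rightarrow> bool" where
  "complex_scaling s \<longleftrightarrow> linear (s \<i>) \<and> (\<forall>c v. s c v = Re c *\<^sub>R v + Im c *\<^sub>R s \<i> v)"

lemma complex_scaling_vec: "complex_scaling ((*s) :: complex \<Rightarrow> complex ^ 'd \<Rightarrow> complex ^ 'd)"
  unfolding complex_scaling_def
  by (auto intro!: linearI simp: vec_eq_iff complex_eq_iff algebra_simps)

lemma complex_scaling_mult: "complex_scaling ((*) :: complex \<Rightarrow> complex \<Rightarrow> complex)"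
  unfolding complex_scaling_def
  by (auto intro!: linearI simp: complex_eq_iff algebra_simps)

lemma complex_scaling_pair: "complex_scaling (scale_pair :: complex \<Rightarrow> _ \<Rightarrow> (complex ^ 'd) \<times> (complex ^ 'd))"
  unfolding complex_scaling_def scale_pair_def
  by (auto intro!: linearI simp: vec_eq_iff complex_eq_iff algebra_simps)

lemma complex_scaling_zero:
  assumes "complex_scaling s"
  shows "s 0 v = 0" "s c 0 = 0"
proof -
  have *: "s c v = Re c *\<^sub>R v + Im c *\<^sub>R s \<i> v" for c v
    using assms unfolding complex_scaling_def by blast
  have lin: "linear (s \<i>)"
    using assms unfolding complex_scaling_def by blast
  show "s 0 v = 0" by (subst *) simp
  show "s c 0 = 0" by (subst *) (simp add: linear_0[OF lin])
qed

text \<open>\<open>complex_scaling\<close> does not make \<open>s \<i>\<close> an isometry, whence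
  the second summand. The bound serves to find discs of a common radius.\<close>

lemma complex_scaling_norm_le:
  assumes "complex_scaling s"
  shows "norm (s c v) \<le> norm c * (norm v + norm (s \<i> v))"
proof -
  have "norm (s c v) \<le> \<bar>Re c\<bar> * norm v + \<bar>Im c\<bar> * norm (s \<i> v)"
    using assms unfolding complex_scaling_def by (metis norm_scaleR norm_triangle_ineq)
  also have "\<dots> \<le> norm c * norm v + norm c * norm (s \<i> v)"
    by (intro add_mono mult_right_mono abs_Re_le_cmod abs_Im_le_cmod) auto
  finally show ?thesis by (simp add: algebra_simps)
qed

lemma complex_scaling_bounded_linear:
  assumes "complex_scaling s"
  shows "bounded_linear (\<lambda>c. s c v)"
proof -
  have "(\<lambda>c. s c v) = (\<lambda>c. Re c *\<^sub>R v + Im c *\<^sub>R s \<i> v)"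
    using assms unfolding complex_scaling_def by blast
  then show ?thesis
    by (auto intro!: bounded_linear_add bounded_linear_scaleR_left[THEN bounded_linear_compose]
        bounded_linear_Re bounded_linear_Im)
qed

lemma hol_on_I:
  assumes "\<And>z. z \<in> S \<Longrightarrow> (f has_derivative f' z) (at z)"
    and "\<And>z c v. z \<in> S \<Longrightarrow> f' z (s c v) = t c (f' z v)"
  shows "hol_on s t f S"
  using assms unfolding hol_on_def by blast

lemma hol_on_derivative:
  assumes "hol_on s t f S" "z \<in> S"
  shows "(f has_derivative frechet_derivative f (at z)) (at z)"
    and "frechet_derivative f (at z) (s c v) = t c (frechet_derivative f (at z) v)"
  using assms frechet_derivative_at unfolding hol_on_def by metis+

lemma hol_on_subset: "hol_on s t f S \<Longrightarrow> T \<subseteq> S \<Longrightarrow> hol_on s t f T"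
  unfolding hol_on_def by blast

lemma hol_on_cong:
  assumes "hol_on s t f S" "open S" "\<And>z. z \<in> S \<Longrightarrow> f z = g z"
  shows "hol_on s t g S"
  using assms unfolding hol_on_def by (meson has_derivative_transform_within_open)

lemma hol_on_continuous: "hol_on s t f S \<Longrightarrow> continuous_on S f"
  unfolding hol_on_def
  by (meson continuous_at_imp_continuous_on has_derivative_continuous)

lemma hol_on_compose:
  assumes "hol_on s t f S" "hol_on t u g T" "f ` S \<subseteq> T"
  shows "hol_on s u (g \<circ> f) S"
  unfolding hol_on_def
proof
  fix z assume z: "z \<in> S"
  obtain f' where f': "(f has_derivative f') (at z)" "\<forall>c v. f' (s c v) = t c (f' v)"
    using assms(1) z unfolding hol_on_def by blast
  obtain g' where g': "(g has_derivative g') (at (f z))" "\<forall>c v. g' (t c v) = u c (g' v)"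
    using assms(2,3) z unfolding hol_on_def by blast
  show "\<exists>h. (g \<circ> f has_derivative h) (at z) \<and> (\<forall>c v. h (s c v) = u c (h v))"
    using diff_chain_at[OF f'(1) g'(1)] f'(2) g'(2) by auto
qed

lemma hol_on_linear:
  assumes "bounded_linear f" "\<And>c v. f (s c v) = t c (f v)"
  shows "hol_on s t f S"
  using assms unfolding hol_on_def
  by (meson bounded_linear_imp_has_derivative)

lemma hol_on_pair:
  assumes "hol_on s (*s) f S" "hol_on s (*s) g S"
  shows "hol_on s scale_pair (\<lambda>z. (f z, g z)) S"
  by (rule hol_on_I[where f' = "\<lambda>z v. (frechet_derivative f (at z) v, frechet_derivative g (at z) v)"])
    (auto simp: scale_pair_def hol_on_derivative[OF assms(1)] hol_on_derivative[OF assms(2)]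
      intro!: has_derivative_Pair)

lemma hol_on_const: "complex_scaling t \<Longrightarrow> hol_on s t (\<lambda>_. a) S"
  by (rule hol_on_I[where f' = "\<lambda>_ _. 0"]) (auto simp: complex_scaling_zero)

lemma hol_on_add:
  fixes f g :: "'a::real_normed_vector \<Rightarrow> complex"
  assumes "hol_on s (*) f S" "hol_on s (*) g S"
  shows "hol_on s (*) (\<lambda>z. f z + g z) S"
  by (rule hol_on_I[where f' = "\<lambda>z v. frechet_derivative f (at z) v + frechet_derivative g (at z) v"])
    (auto simp: algebra_simps hol_on_derivative[OF assms(1)] hol_on_derivative[OF assms(2)]
      intro!: has_derivative_add)

lemma hol_on_mult:
  fixes f g :: "'a::real_normed_vector \<Rightarrow> complex"
  assumes "hol_on s (*) f S" "hol_on s (*) g S"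
  shows "hol_on s (*) (\<lambda>z. f z * g z) S"
proof (rule hol_on_I)
  fix z assume z: "z \<in> S"
  show "((\<lambda>z. f z * g z) has_derivative
      (\<lambda>v. f z * frechet_derivative g (at z) v + frechet_derivative f (at z) v * g z)) (at z)"
    by (intro has_derivative_mult hol_on_derivative(1)[OF assms(1) z] hol_on_derivative(1)[OF assms(2) z])
  show "f z * frechet_derivative g (at z) (s c v) + frechet_derivative f (at z) (s c v) * g z =
      c * (f z * frechet_derivative g (at z) v + frechet_derivative f (at z) v * g z)" for c v
    by (simp add: hol_on_derivative(2)[OF assms(1) z] hol_on_derivative(2)[OF assms(2) z] algebra_simps)
qed

section \<open>Restriction to complex lines, Cauchy's formula, holomorphy of derivatives\<close>

lemma hol_on_line:
  fixes f :: "'a::real_normed_vector \<Rightarrow> complex"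
  assumes f: "hol_on s (*) f S" and s: "complex_scaling s" and z: "z + s \<zeta> v \<in> S"
  shows "((\<lambda>\<zeta>. f (z + s \<zeta> v)) has_field_derivative frechet_derivative f (at (z + s \<zeta> v)) v) (at \<zeta>)"
proof -
  let ?f' = "frechet_derivative f (at (z + s \<zeta> v))"
  have "((\<lambda>\<zeta>. z + s \<zeta> v) has_derivative (\<lambda>\<zeta>. s \<zeta> v)) (at \<zeta>)"
    using bounded_linear_imp_has_derivative[OF complex_scaling_bounded_linear[OF s]]
    by (auto intro!: derivative_eq_intros)
  from diff_chain_at[OF this hol_on_derivative(1)[OF f z]]
  have "((\<lambda>\<zeta>. f (z + s \<zeta> v)) has_derivative (\<lambda>\<zeta>. ?f' (s \<zeta> v))) (at \<zeta>)"
    by (simp add: o_def)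
  moreover have "(\<lambda>\<zeta>. ?f' (s \<zeta> v)) = (*) (?f' v)"
    using hol_on_derivative(2)[OF f z] by (auto simp: mult.commute)
  ultimately show ?thesis unfolding has_field_derivative_def by simp
qed

text \<open>Along the line \<open>z + s \<zeta> v\<close> this is Cauchy's formula for a derivative
  at 0 in one variable. The circle \<open>c\<close> satisfies \<open>c' = 2 * pi * \<i> * c\<close>,
  which turns \<open>c' / c^2\<close> into a multiple of \<open>1 / c\<close>. The right-hand side
  involves only values of \<open>f\<close>, so \<open>z\<close> becomes the parameter of an
  integral.\<close>

lemma Cauchy_directional:
  fixes f :: "'a::euclidean_space \<Rightarrow> complex"
  assumes f: "hol_on s (*) f S" and s: "complex_scaling s" and "0 < r"
    and z: "\<And>\<zeta>. norm \<zeta> \<le> r \<Longrightarrow> z + s \<zeta> v \<in> S"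
  shows "frechet_derivative f (at z) v =
    integral {0..1} (\<lambda>t. f (z + s (circlepath 0 r t) v) / circlepath 0 r t)"
proof -
  let ?g = "\<lambda>\<zeta>. f (z + s \<zeta> v)" and ?c = "circlepath 0 r"
  have s0: "s 0 v = 0" by (rule complex_scaling_zero[OF s])
  have d: "(?g has_field_derivative frechet_derivative f (at (z + s \<zeta> v)) v) (at \<zeta>)"
    if "norm \<zeta> \<le> r" for \<zeta>
    using hol_on_line[OF f s z[OF that]] .
  have cont: "continuous_on (cball 0 r) ?g"
    by (intro continuous_at_imp_continuous_on ballI) (metis d DERIV_isCont dist_0_norm mem_cball)
  have hol: "?g holomorphic_on ball 0 r"
    unfolding holomorphic_on_def
    using d by (metis dist_0_norm field_differentiable_def has_field_derivative_at_within
        less_imp_le mem_ball)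
  have "(?g has_field_derivative (1 / (2 * of_real pi * \<i>) *
      contour_integral ?c (\<lambda>u. ?g u / (u - 0)^2))) (at 0)"
    by (rule Cauchy_derivative_integral_circlepath(2)[OF cont hol]) (use \<open>0 < r\<close> in auto)
  with d[of 0] \<open>0 < r\<close> have "frechet_derivative f (at z) v =
      1 / (2 * of_real pi * \<i>) * contour_integral ?c (\<lambda>u. ?g u / (u - 0)^2)"
    by (auto simp: s0 intro: DERIV_unique)
  also have "\<dots> = integral {0..1} (\<lambda>t. 1 / (2 * of_real pi * \<i>) *
      (?g (?c t) / (?c t)^2 * vector_derivative ?c (at t)))"
    by (simp only: contour_integral_integral integral_mult_right power2_eq_square diff_zero)
  also have "\<dots> = integral {0..1} (\<lambda>t. f (z + s (?c t) v) / ?c t)"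
  proof (rule integral_cong)
    fix t :: real
    have "?c t \<noteq> 0" using \<open>0 < r\<close> by (simp add: circlepath)
    moreover have "vector_derivative ?c (at t) = 2 * pi * \<i> * ?c t"
      unfolding vector_derivative_circlepath by (simp add: circlepath mult_ac)
    ultimately show "1 / (2 * of_real pi * \<i>) * (?g (?c t) / (?c t)^2 * vector_derivative ?c (at t)) =
        f (z + s (?c t) v) / ?c t"
      by (simp add: field_simps power2_eq_square)
  qed
  finally show ?thesis .
qed

lemma continuous_on_circlepath:
  "continuous_on X g \<Longrightarrow> continuous_on X (\<lambda>x. circlepath z r (g x))"
  unfolding circlepath by (intro continuous_intros)

text \<open>Uniformity is the point: one radius serves all \<open>z'\<close> near \<open>z\<close>,
  so Cauchy's formula holds on a whole ball with a fixed contour.\<close>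

lemma hol_on_uniform_disc:
  fixes v :: "'a::real_normed_vector"
  assumes "open S" "z \<in> S" "complex_scaling s"
  obtains \<epsilon> r where "0 < \<epsilon>" "0 < r"
    "\<And>z' \<zeta>. z' \<in> ball z \<epsilon> \<Longrightarrow> norm \<zeta> \<le> r \<Longrightarrow> z' + s \<zeta> v \<in> S"
proof -
  obtain \<epsilon> where \<epsilon>: "0 < \<epsilon>" "ball z \<epsilon> \<subseteq> S" using assms openE by blast
  \<comment> \<open>\<open>M\<close> bounds the stretching of \<open>\<zeta>\<close> to
    \<open>s \<zeta> v\<close>; the summand 1 keeps it positive as a divisor when
    \<open>v = 0\<close>. One half of \<open>\<epsilon>\<close> is spent on
    \<open>s \<zeta> v\<close>, the other on the displacement of \<open>z'\<close>.\<close>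
  define M where "M = norm v + norm (s \<i> v) + 1"
  have M: "M > 0" unfolding M_def by (smt (verit) norm_ge_zero)
  have "z' + s \<zeta> v \<in> S" if "z' \<in> ball z (\<epsilon>/2)" "norm \<zeta> \<le> \<epsilon> / (2 * M)" for z' \<zeta>
  proof -
    have "norm (s \<zeta> v) \<le> norm \<zeta> * M"
      using complex_scaling_norm_le[OF assms(3), of \<zeta> v] unfolding M_def
      by (smt (verit) mult_left_mono norm_ge_zero)
    also have "\<dots> \<le> \<epsilon> / 2" using that(2) M by (simp add: field_simps)
    finally have "dist z (z' + s \<zeta> v) < \<epsilon>"
      using that(1) by (simp add: dist_norm) (smt (verit) norm_triangle_ineq4 diff_diff_add)
    then show ?thesis using \<epsilon> by auto
  qed
  then show thesis using that[of "\<epsilon>/2" "\<epsilon> / (2 * M)"] \<epsilon> M by auto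
qed

text \<open>\<open>hol_on\<close> asserts no continuity of derivatives; it comes from the parameter
  integral, whose integrand is continuous because \<open>f\<close> is.\<close>

lemma hol_on_continuous_derivative:
  fixes f :: "'a::euclidean_space \<Rightarrow> complex"
  assumes f: "hol_on s (*) f S" and s: "complex_scaling s" and "open S"
  shows "continuous_on S (\<lambda>z. frechet_derivative f (at z) v)"
proof (intro continuous_at_imp_continuous_on ballI)
  fix z assume "z \<in> S"
  obtain \<epsilon> r where er: "0 < \<epsilon>" "0 < r"
    "\<And>z' \<zeta>. z' \<in> ball z \<epsilon> \<Longrightarrow> norm \<zeta> \<le> r \<Longrightarrow> z' + s \<zeta> v \<in> S"
    using hol_on_uniform_disc[OF \<open>open S\<close> \<open>z \<in> S\<close> s] by metis
  let ?c = "circlepath 0 r"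
  have c: "norm (?c t) = r" "?c t \<noteq> 0" for t using er(2) by (auto simp: circlepath norm_mult)
  have "continuous_on (ball z \<epsilon> \<times> cbox 0 1) (\<lambda>(z', t). f (z' + s (?c t) v) / ?c t)"
    unfolding split_beta
    by (intro continuous_intros continuous_on_compose2[OF hol_on_continuous[OF f]]
        bounded_linear.continuous_on[OF complex_scaling_bounded_linear[OF s]]
        continuous_on_circlepath)
      (use c er in auto)
  from integral_continuous_on_param[OF this]
  have "continuous_on (ball z \<epsilon>) (\<lambda>z'. integral {0..1} (\<lambda>t. f (z' + s (?c t) v) / ?c t))"
    by simp
  then have "continuous_on (ball z \<epsilon>) (\<lambda>z. frechet_derivative f (at z) v)"
    by (rule continuous_on_eq) (auto intro!: Cauchy_directional[OF f s er(2), symmetric] er(3) simp: dist_norm)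
  then show "isCont (\<lambda>z. frechet_derivative f (at z) v) z"
    using er(1) by (simp add: continuous_on_eq_continuous_at)
qed

text \<open>Cauchy's integral is differentiated under the integral sign. The Leibniz rule wants the
  derivative of the integrand jointly continuous as a bounded linear map, which rests on
  \<open>hol_on_continuous_derivative\<close>; complex linearity passes from the integrand to the
  integral.\<close>

lemma hol_on_directional_derivative:
  fixes f :: "'a::euclidean_space \<Rightarrow> complex"
  assumes f: "hol_on s (*) f S" and s: "complex_scaling s" and "open S"
  shows "hol_on s (*) (\<lambda>z. frechet_derivative f (at z) v) S"
  unfolding hol_on_def
proof
  fix z assume "z \<in> S"
  obtain \<epsilon> r where er: "0 < \<epsilon>" "0 < r"
    "\<And>z' \<zeta>. z' \<in> ball z \<epsilon> \<Longrightarrow> norm \<zeta> \<le> r \<Longrightarrow> z' + s \<zeta> v \<in> S"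
    using hol_on_uniform_disc[OF \<open>open S\<close> \<open>z \<in> S\<close> s] by metis
  let ?c = "circlepath 0 r"
  define f' where "f' z = Blinfun (frechet_derivative f (at z))" for z
  have f': "blinfun_apply (f' z) = frechet_derivative f (at z)" if "z \<in> S" for z
    unfolding f'_def
    using hol_on_derivative(1)[OF f that] by (simp add: bounded_linear_Blinfun_apply has_derivative_bounded_linear)
  \<comment> \<open>In finite dimension continuity in the operator norm can be checked on basis
    vectors.\<close>
  have contf': "continuous_on S f'"
  proof (rule continuous_on_blinfun_componentwise)
    fix i :: 'a
    show "continuous_on S (\<lambda>x. blinfun_apply (f' x) i)"
      using hol_on_continuous_derivative[OF f s \<open>open S\<close>, of i]
      by (rule continuous_on_eq) (simp add: f')
  qed
  have c: "norm (?c t) = r" "?c t \<noteq> 0" for t using er(2) by (auto simp: circlepath norm_mult)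
  \<comment> \<open>The derivative of Cauchy's integrand in its first argument, packaged as a
    bounded linear map.\<close>
  define A where "A z' t = blinfun_compose (blinfun_mult_left (1 / ?c t)) (f' (z' + s (?c t) v))" for z' t
  have A: "blinfun_apply (A z' t) w = frechet_derivative f (at (z' + s (?c t) v)) w / ?c t"
    if "z' \<in> ball z \<epsilon>" for z' t w
    using f'[OF er(3)[OF that]] c by (simp add: A_def)
  have contA: "continuous_on (ball z \<epsilon> \<times> cbox 0 1) (\<lambda>(x, t). A x t)"
    unfolding split_beta A_def
    by (intro continuous_intros continuous_on_compose2[OF contf']
        bounded_linear.continuous_on[OF complex_scaling_bounded_linear[OF s]]
        bounded_linear.continuous_on[OF bounded_linear_blinfun_mult_left]
        continuous_on_circlepath)
      (use c er in auto)
  have "((\<lambda>x. integral (cbox 0 1) (\<lambda>t. f (x + s (?c t) v) / ?c t)) has_derivative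
      blinfun_apply (integral (cbox 0 1) (A z))) (at z within ball z \<epsilon>)"
  proof (rule leibniz_rule)
    fix x and t :: real assume x: "x \<in> ball z \<epsilon>"
    let ?y = "x + s (?c t) v"
    have "((\<lambda>x. x + s (?c t) v) has_derivative (\<lambda>h. h)) (at x within ball z \<epsilon>)"
      by (auto intro!: derivative_eq_intros)
    from has_derivative_compose[OF this hol_on_derivative(1)[OF f er(3)[OF x]]] c
    have D: "((\<lambda>x. f (x + s (?c t) v)) has_derivative frechet_derivative f (at ?y)) (at x within ball z \<epsilon>)"
      by auto
    have blinfun_eq: "blinfun_apply (A x t) = (\<lambda>w. frechet_derivative f (at ?y) w * (1 / ?c t))"
      by (simp add: A[OF x] fun_eq_iff)
    from has_derivative_mult_left[OF D, of "1 / ?c t"]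
    show "((\<lambda>x. f (x + s (?c t) v) / ?c t) has_derivative blinfun_apply (A x t)) (at x within ball z \<epsilon>)"
      unfolding blinfun_eq by (simp only: times_divide_eq_right mult_1_right)
  next
    fix x assume x: "x \<in> ball z \<epsilon>"
    show "(\<lambda>t. f (x + s (?c t) v) / ?c t) integrable_on cbox 0 1"
      by (intro integrable_continuous continuous_intros continuous_on_compose2[OF hol_on_continuous[OF f]]
        bounded_linear.continuous_on[OF complex_scaling_bounded_linear[OF s]]
        continuous_on_circlepath) (use c er x in auto)
  qed (use er contA in auto)
  moreover have "at z within ball z \<epsilon> = at z"
    using er(1) by (intro at_within_open) auto
  ultimately have "((\<lambda>x. integral {0..1} (\<lambda>t. f (x + s (?c t) v) / ?c t)) has_derivative
      blinfun_apply (integral (cbox 0 1) (A z))) (at z)"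
    by (simp only: box_real)
  then have D: "((\<lambda>z. frechet_derivative f (at z) v) has_derivative
      blinfun_apply (integral (cbox 0 1) (A z))) (at z)"
    by (rule has_derivative_transform_within_open[where s = "ball z \<epsilon>"])
      (use er in \<open>auto intro!: Cauchy_directional[OF f s er(2), symmetric] er(3)\<close>)
  have "continuous_on (cbox 0 1) (\<lambda>t. case (z, t) of (x, t) \<Rightarrow> A x t)"
    by (rule continuous_on_compose2[OF contA]) (use er(1) in \<open>auto intro!: continuous_intros\<close>)
  then have int: "A z integrable_on cbox 0 1"
    by (intro integrable_continuous) simp
  have "blinfun_apply (integral (cbox 0 1) (A z)) (s a w) = a * blinfun_apply (integral (cbox 0 1) (A z)) w"
    for a w
  proof -
    have zb: "z \<in> ball z \<epsilon>" using er by simp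
    have "blinfun_apply (A z t) (s a w) = a * blinfun_apply (A z t) w" for t
      unfolding A[OF zb] using hol_on_derivative(2)[OF f er(3)[OF zb]] c by simp
    then show ?thesis by (simp only: blinfun_apply_integral[OF int] integral_mult_right)
  qed
  with D show "\<exists>f'. ((\<lambda>z. frechet_derivative f (at z) v) has_derivative f') (at z) \<and>
      (\<forall>c v. f' (s c v) = c * f' v)" by blast
qed

section \<open>A vanishing criterion; orthonormal bases\<close>

text \<open>A nonconstant \<open>f\<close> would factor near 0 as \<open>z^n\<close> times a
  function without zeros, and flatness to order \<open>n + 1\<close> forces that factor to tend to
  0. Nonconstancy on the large ball already yields the factorisation, so bounds on the small disc
  decide the large one.\<close>

lemma holomorphic_flat_zero:
  assumes hol: "f holomorphic_on ball 0 R" and "0 < r" "r \<le> R" and t: "norm t < R"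
    and flat: "\<And>n. \<exists>C. \<forall>z. norm z < r \<longrightarrow> norm (f z) \<le> C * norm z ^ n"
  shows "f t = 0"
proof (rule ccontr)
  assume ft: "f t \<noteq> 0"
  have f0: "f 0 = 0"
  proof -
    obtain C where "\<And>z. norm z < r \<Longrightarrow> norm (f z) \<le> C * norm z ^ 1" using flat by blast
    from this[of 0] show ?thesis using \<open>0 < r\<close> by simp
  qed
  have nc: "\<not> f constant_on ball 0 R"
  proof
    assume "f constant_on ball 0 R"
    then obtain c where "\<And>x. x \<in> ball 0 R \<Longrightarrow> f x = c" unfolding constant_on_def by auto
    from this[of t] this[of 0] show False using ft f0 t \<open>0 < r\<close> \<open>r \<le> R\<close> by auto
  qed
  have z0: "0 \<in> ball (0::complex) R" using \<open>0 < r\<close> \<open>r \<le> R\<close> by simp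
  obtain g \<rho> n where g: "0 < n" "0 < \<rho>" "ball (0::complex) \<rho> \<subseteq> ball 0 R" "g holomorphic_on ball 0 \<rho>"
    "\<And>w. w \<in> ball 0 \<rho> \<Longrightarrow> f w = (w - 0)^n * g w" "\<And>w. w \<in> ball 0 \<rho> \<Longrightarrow> g w \<noteq> 0"
    by (rule holomorphic_factor_zero_nonconstant[OF hol open_ball connected_ball z0 f0 nc]) (rule that)
  obtain C where C: "\<And>z. norm z < r \<Longrightarrow> norm (f z) \<le> C * norm z ^ Suc n"
    using flat by blast
  have le: "norm (g w) \<le> C * norm w" if "w \<noteq> 0" "norm w < min r \<rho>" for w
  proof -
    have "norm w ^ n * norm (g w) \<le> norm w ^ n * (C * norm w)"
      using C[of w] g(5)[of w] that by (simp add: norm_mult norm_power mult_ac)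
    then show ?thesis using that by (simp add: mult_le_cancel_left_pos)
  qed
  have "(g \<longlongrightarrow> g 0) (at 0)"
    using g(2,4) holomorphic_on_imp_continuous_on continuous_on_eq_continuous_at isContD
    by (metis centre_in_ball open_ball)
  moreover have "(g \<longlongrightarrow> 0) (at 0)"
  proof (rule Lim_null_comparison)
    show "\<forall>\<^sub>F w in at 0. norm (g w) \<le> C * norm w"
      unfolding eventually_at using le \<open>0 < r\<close> g(2) by (intro exI[of _ "min r \<rho>"]) auto
    show "((\<lambda>w. C * norm w) \<longlongrightarrow> 0) (at 0)"
      by (auto intro!: tendsto_eq_intros)
  qed
  ultimately have "g 0 = 0" by (rule tendsto_unique[rotated]) simp
  then show False using g(2,6) by auto
qed

text \<open>The index type may be infinite and no common bound on the family is assumed, so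
  Gronwall's inequality for a norm of the whole family is out of reach. But each equation has
  finitely many terms: by induction on \<open>n\<close> every \<open>p i\<close> is bounded by a
  multiple of \<open>norm t ^ n\<close>, one integration gaining one power. Then
  \<open>holomorphic_flat_zero\<close> applies.\<close>

lemma linear_ode_family_zero:
  fixes p :: "'i \<Rightarrow> complex \<Rightarrow> complex" and b :: "'l::finite \<Rightarrow> complex \<Rightarrow> complex"
  assumes d: "\<And>i t. norm t < R \<Longrightarrow>
      (p i has_field_derivative (\<Sum>l\<in>UNIV. b l t * p (\<sigma> l i) t)) (at t)"
    and b: "\<And>l. continuous_on (ball 0 R) (b l)"
    and p0: "\<And>i. p i 0 = 0" and t: "norm t < R"
  shows "p i t = 0"
proof -
  \<comment> \<open>The estimates use bounds for \<open>b l\<close> and \<open>p i\<close>, hence a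
    closed disc strictly inside the domain.\<close>
  define r where "r = R / 2"
  have R: "0 < R" using t by (smt (verit) norm_ge_zero)
  then have r: "0 < r" "r < R" unfolding r_def by auto
  have "compact (cball (0::complex) r)" by simp
  have "\<exists>M. \<forall>t\<in>cball 0 r. norm (b l t) \<le> M" for l
    using compact_continuous_image[OF continuous_on_subset[OF b] \<open>compact (cball 0 r)\<close>, of l] r
    by (force dest!: compact_imp_bounded simp: bounded_iff)
  then obtain M where M: "\<And>l t. t \<in> cball 0 r \<Longrightarrow> norm (b l t) \<le> M l" by metis
  have contp: "continuous_on (cball 0 r) (p i)" for i
    by (intro continuous_at_imp_continuous_on ballI DERIV_isCont[OF d]) (use r in auto)
  \<comment> \<open>The constant may depend on both \<open>i\<close> and \<open>n\<close>. All
    \<open>i\<close> are treated at once, since step \<open>n + 1\<close> for \<open>i\<close> uses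
    step \<open>n\<close> for every \<open>\<sigma> l i\<close>.\<close>
  have flat: "\<exists>C\<ge>0. \<forall>t\<in>cball 0 r. norm (p i t) \<le> C * norm t ^ n" for n i
  proof (induction n arbitrary: i)
    case 0
    have "bounded (p i ` cball 0 r)"
      using compact_continuous_image[OF contp \<open>compact (cball 0 r)\<close>] compact_imp_bounded by blast
    then obtain B where "B > 0" "\<forall>x\<in>p i ` cball 0 r. norm x \<le> B"
      using bounded_pos by blast
    then show ?case by (intro exI[of _ B]) auto
  next
    case (Suc n)
    then obtain C where C: "\<And>i. C i \<ge> 0" "\<And>i t. t \<in> cball 0 r \<Longrightarrow> norm (p i t) \<le> C i * norm t ^ n"
      by metis
    define K where "K = (\<Sum>l\<in>UNIV. \<bar>M l\<bar> * C (\<sigma> l i))"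
    have "norm (p i t) \<le> K * norm t ^ Suc n" if t: "t \<in> cball 0 r" for t
    proof -
      \<comment> \<open>Mean value estimate on the disc of radius \<open>norm t\<close>, where the
        induction hypothesis bounds the derivative by \<open>K * norm t ^ n\<close>.\<close>
      have "norm (p i t - p i 0) \<le> (K * norm t ^ n) * norm (t - 0)"
      proof (rule field_differentiable_bound[where S = "cball 0 (norm t)"])
        fix u :: complex assume u: "u \<in> cball 0 (norm t)"
        with t r have ur: "u \<in> cball 0 r" "norm u < R" by auto
        show "(p i has_field_derivative (\<Sum>l\<in>UNIV. b l u * p (\<sigma> l i) u)) (at u within cball 0 (norm t))"
          using d[OF ur(2)] has_field_derivative_at_within by blast
        have "norm (\<Sum>l\<in>UNIV. b l u * p (\<sigma> l i) u) \<le> (\<Sum>l\<in>UNIV. norm (b l u) * norm (p (\<sigma> l i) u))"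
          by (rule order_trans[OF norm_sum]) (simp add: norm_mult)
        also have "\<dots> \<le> (\<Sum>l\<in>UNIV. \<bar>M l\<bar> * (C (\<sigma> l i) * norm t ^ n))"
        proof (intro sum_mono mult_mono)
          fix l
          show "norm (b l u) \<le> \<bar>M l\<bar>" using M[OF ur(1), of l] by linarith
          have "norm (p (\<sigma> l i) u) \<le> C (\<sigma> l i) * norm u ^ n" by (rule C(2)[OF ur(1)])
          also have "\<dots> \<le> C (\<sigma> l i) * norm t ^ n"
            using u C(1) by (intro mult_left_mono power_mono) auto
          finally show "norm (p (\<sigma> l i) u) \<le> C (\<sigma> l i) * norm t ^ n" .
        qed auto
        also have "\<dots> = K * norm t ^ n" unfolding K_def by (simp add: sum_distrib_right mult.assoc)
        finally show "norm (\<Sum>l\<in>UNIV. b l u * p (\<sigma> l i) u) \<le> K * norm t ^ n" .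
      qed auto
      then show ?thesis using p0 by (simp add: mult_ac)
    qed
    moreover have "K \<ge> 0" unfolding K_def using C(1) by (intro sum_nonneg) auto
    ultimately show ?case by blast
  qed
  have "p i holomorphic_on ball 0 R"
    unfolding holomorphic_on_def field_differentiable_def
    using d has_field_derivative_at_within by (metis dist_0_norm mem_ball)
  then show ?thesis
  proof (rule holomorphic_flat_zero)
    show "\<exists>C. \<forall>z. norm z < r \<longrightarrow> norm (p i z) \<le> C * norm z ^ n" for n
      using flat[of i n] by (meson less_imp_le mem_cball_0)
  qed (use r t in auto)
qed

section \<open>Orthonormal bases for possibly indefinite forms, and traces over them\<close>

lemma symmetric_bilinear_on_sum_left:
  assumes "symmetric_bilinear_on V h" "subspace V" "z \<in> V" "finite B" "B \<subseteq> V"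
  shows "h (\<Sum>f\<in>B. a f *\<^sub>R f) z = (\<Sum>f\<in>B. a f * h f z)"
proof -
  have add: "h (x + y) z = h x z + h y z" if "x \<in> V" "y \<in> V" for x y
    using assms(1,3) that unfolding symmetric_bilinear_on_def by blast
  have scale: "h (c *\<^sub>R x) z = c * h x z" if "x \<in> V" for c x
    using assms(1,3) that unfolding symmetric_bilinear_on_def by blast
  show ?thesis
    using assms(4,5)
  proof (induction B)
    case empty
    have "h (0 *\<^sub>R z) z = 0 * h z z"
      using assms(1,3) unfolding symmetric_bilinear_on_def by blast
    then show ?case by simp
  next
    case (insert f B)
    have "(\<Sum>f\<in>B. a f *\<^sub>R f) \<in> V" "a f *\<^sub>R f \<in> V" "f \<in> V"
      using insert assms(2) by (auto intro!: subspace_sum subspace_scale)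
    then have "h (a f *\<^sub>R f + (\<Sum>f\<in>B. a f *\<^sub>R f)) z = a f * h f z + h (\<Sum>f\<in>B. a f *\<^sub>R f) z"
      using add scale by metis
    then show ?case using insert by simp
  qed
qed

text \<open>\<open>h\<close> may be indefinite: pairing with \<open>a\<close> kills the span of the
  other vectors but not \<open>a\<close>, as \<open>h a a\<close> is 1 or -1.\<close>

lemma orthonormal_independent:
  assumes h: "symmetric_bilinear_on V h" and V: "subspace V" "B \<subseteq> V"
    and unit: "\<And>x. x \<in> B \<Longrightarrow> \<bar>h x x\<bar> = 1"
    and orth: "\<And>x y. x \<in> B \<Longrightarrow> y \<in> B \<Longrightarrow> x \<noteq> y \<Longrightarrow> h x y = 0"
  shows "independent B"
  unfolding dependent_def
proof
  assume "\<exists>a\<in>B. a \<in> span (B - {a})"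
  then obtain a where a: "a \<in> B" "a \<in> span (B - {a})" by blast
  have aV: "a \<in> V" using a V by auto
  have "subspace {y \<in> V. h y a = 0}"
  proof (rule subspaceI)
    have "h (0 *\<^sub>R a) a = 0 * h a a"
      using h aV unfolding symmetric_bilinear_on_def by blast
    then show "0 \<in> {y \<in> V. h y a = 0}" using V(1) by (simp add: subspace_0)
  qed (use h V aV in \<open>auto simp: symmetric_bilinear_on_def subspace_add subspace_scale\<close>)
  moreover have "B - {a} \<subseteq> {y \<in> V. h y a = 0}" using a(1) V orth by auto
  ultimately have "span (B - {a}) \<subseteq> {y \<in> V. h y a = 0}" by (rule span_minimal[rotated])
  then show False using a unit[of a] by auto
qed

lemma orthonormal_basis_subset: "orthonormal_basis h V B \<Longrightarrow> B \<subseteq> V"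
  unfolding orthonormal_basis_def using span_superset by blast

text \<open>The coefficient at \<open>f\<close> is \<open>h e f\<close> divided by
  \<open>h f f\<close>; since \<open>h f f\<close> is 1 or -1, this equals multiplication by
  it.\<close>

lemma orthonormal_basis_expansion:
  fixes V :: "'a::euclidean_space set"
  assumes h: "symmetric_bilinear_on V h" and B: "orthonormal_basis h V B" and e: "e \<in> V"
  shows "e = (\<Sum>f\<in>B. (h f f * h e f) *\<^sub>R f)"
proof -
  have ind: "independent B" and sp: "span B = V" and BV: "B \<subseteq> V"
    using B orthonormal_basis_subset[OF B] unfolding orthonormal_basis_def by auto
  have fin: "finite B" using ind independent_imp_finite by blast
  have V: "subspace V" using sp subspace_span by metis
  obtain a where a: "e = (\<Sum>f\<in>B. a f *\<^sub>R f)"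
    using e sp span_finite[OF fin] by auto
  have "h f f * h e f = a f" if "f \<in> B" for f
  proof -
    have "h e f = (\<Sum>g\<in>B. a g * h g f)"
      unfolding a using that BV by (intro symmetric_bilinear_on_sum_left[OF h V _ fin BV]) auto
    also have "\<dots> = (\<Sum>g\<in>B. if g = f then a f * h f f else 0)"
      using B that unfolding orthonormal_basis_def by (intro sum.cong) auto
    also have "\<dots> = a f * h f f" using fin that by simp
    finally have "h f f * h e f = a f * (h f f * h f f)" by simp
    moreover have "h f f * h f f = 1"
      using B that unfolding orthonormal_basis_def by (metis abs_mult_self_eq mult_1)
    ultimately show ?thesis by simp
  qed
  with a show ?thesis by (metis (mono_tags, lifting) sum.cong)
qed

text \<open>\<open>tension\<close> and \<open>conformality\<close> use a basis picked by choice;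
  this allows passing to an adapted one. Vectors of \<open>B\<close> are expanded in
  \<open>C\<close>. After exchanging sums, the inner sum over \<open>B\<close> is the expansion of
  \<open>f\<close> in \<open>B\<close> paired with \<open>g\<close>, that is \<open>h f g\<close>,
  so only the diagonal of \<open>C\<close> survives.\<close>

lemma orthonormal_trace_unique:
  fixes V :: "'a::euclidean_space set" and \<beta> :: "'a \<Rightarrow> 'a \<Rightarrow> complex"
  assumes h: "symmetric_bilinear_on V h" and \<beta>: "bilinear \<beta>"
    and B: "orthonormal_basis h V B" and C: "orthonormal_basis h V C"
  shows "(\<Sum>e\<in>B. of_real (h e e) * \<beta> e e) = (\<Sum>f\<in>C. of_real (h f f) * \<beta> f f)"
proof -
  have finB: "finite B" and finC: "finite C"
    using B C independent_imp_finite unfolding orthonormal_basis_def by blast+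
  have BV: "B \<subseteq> V" and CV: "C \<subseteq> V" using orthonormal_basis_subset B C by blast+
  have sym: "h x y = h y x" if "x \<in> V" "y \<in> V" for x y
    using h that unfolding symmetric_bilinear_on_def by blast
  have V: "subspace V" using B subspace_span unfolding orthonormal_basis_def by metis
  have "\<beta> e e = (\<Sum>f\<in>C. \<Sum>g\<in>C. of_real (h f f * h e f * (h g g * h e g)) * \<beta> f g)" if "e \<in> B" for e
  proof -
    have ex: "e = (\<Sum>f\<in>C. (h f f * h e f) *\<^sub>R f)"
      using orthonormal_basis_expansion[OF h C] that BV by blast
    have "\<beta> e e = \<beta> (\<Sum>f\<in>C. (h f f * h e f) *\<^sub>R f) (\<Sum>f\<in>C. (h f f * h e f) *\<^sub>R f)"
      using ex by metis
    also have "\<dots> = (\<Sum>f\<in>C. \<Sum>g\<in>C. \<beta> ((h f f * h e f) *\<^sub>R f) ((h g g * h e g) *\<^sub>R g))"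
      by (simp add: bilinear_sum[OF \<beta>] sum.cartesian_product)
    also have "\<dots> = (\<Sum>f\<in>C. \<Sum>g\<in>C. of_real (h f f * h e f * (h g g * h e g)) * \<beta> f g)"
      by (simp add: bilinear_lmul[OF \<beta>] bilinear_rmul[OF \<beta>] scaleR_conv_of_real mult_ac)
    finally show ?thesis .
  qed
  then have "(\<Sum>e\<in>B. of_real (h e e) * \<beta> e e) =
      (\<Sum>e\<in>B. \<Sum>f\<in>C. \<Sum>g\<in>C. of_real (h e e * (h f f * h e f * (h g g * h e g))) * \<beta> f g)"
    by (simp add: sum_distrib_left mult_ac)
  also have "\<dots> = (\<Sum>f\<in>C. \<Sum>g\<in>C. \<Sum>e\<in>B. of_real (h e e * (h f f * h e f * (h g g * h e g))) * \<beta> f g)"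
    by (subst sum.swap) (intro sum.cong refl sum.swap)
  also have "\<dots> = (\<Sum>f\<in>C. \<Sum>g\<in>C. of_real (h f f * h g g * h f g) * \<beta> f g)"
  proof (intro sum.cong refl)
    fix f g assume fg: "f \<in> C" "g \<in> C"
    have "h f g = h (\<Sum>e\<in>B. (h e e * h f e) *\<^sub>R e) g"
      using orthonormal_basis_expansion[OF h B, of f] fg CV by auto
    also have "\<dots> = (\<Sum>e\<in>B. h e e * h f e * h e g)"
      using fg CV by (intro symmetric_bilinear_on_sum_left[OF h V _ finB BV]) auto
    also have "\<dots> = (\<Sum>e\<in>B. h e e * h e f * h e g)"
      using fg CV BV by (intro sum.cong refl) (metis sym subsetD)
    finally have "h f f * h g g * h f g = (\<Sum>e\<in>B. h e e * (h f f * h e f * (h g g * h e g)))"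
      by (simp add: sum_distrib_left mult_ac)
    then show "(\<Sum>e\<in>B. of_real (h e e * (h f f * h e f * (h g g * h e g))) * \<beta> f g) =
        of_real (h f f * h g g * h f g) * \<beta> f g"
      by (simp only: sum_distrib_right[symmetric] of_real_sum[symmetric])
  qed
  also have "\<dots> = (\<Sum>f\<in>C. \<Sum>g\<in>C. if g = f then of_real (h f f) * \<beta> f f else 0)"
  proof (intro sum.cong refl)
    fix f g assume fg: "f \<in> C" "g \<in> C"
    have "h f f * h f f = 1"
      using C fg unfolding orthonormal_basis_def by (metis abs_mult_self_eq mult_1)
    then have "of_real (h f f) * of_real (h f f) = (1::complex)"
      by (metis of_real_1 of_real_mult)
    then show "of_real (h f f * h g g * h f g) * \<beta> f g = (if g = f then of_real (h f f) * \<beta> f f else 0)"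
      using C fg unfolding orthonormal_basis_def by (cases "g = f") auto
  qed
  also have "\<dots> = (\<Sum>f\<in>C. of_real (h f f) * \<beta> f f)" using finC by simp
  finally show ?thesis .
qed

text \<open>Gram-Schmidt as induction on the dimension: split off a unit vector \<open>u\<close> and
  continue in its orthogonal complement \<open>V'\<close>.\<close>

lemma orthonormal_basis_exists:
  fixes V :: "'a::euclidean_space set"
  assumes "symmetric_bilinear_on V h" "subspace V" "\<And>x. x \<in> V \<Longrightarrow> x \<noteq> 0 \<Longrightarrow> h x x > 0"
  shows "\<exists>B. orthonormal_basis h V B"
  using assms
proof (induction "dim V" arbitrary: V rule: less_induct)
  case less
  note h = less.prems(1) and V = less.prems(2) and pos = less.prems(3)
  show ?case
  proof (cases "V = {0}")
    case True
    then have "orthonormal_basis h V {}" unfolding orthonormal_basis_def by (simp add: independent_empty)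
    then show ?thesis by blast
  next
    case False
    then obtain v where v: "v \<in> V" "v \<noteq> 0" using V subspace_0 by blast
    have scale: "h (a *\<^sub>R x) y = a * h x y" "h y (a *\<^sub>R x) = a * h y x" if "x \<in> V" "y \<in> V" for a x y
      using h that V subspace_scale unfolding symmetric_bilinear_on_def by metis+
    have add: "h (x + y) z = h x z + h y z" if "x \<in> V" "y \<in> V" "z \<in> V" for x y z
      using h that unfolding symmetric_bilinear_on_def by blast
    define u where "u = (1 / sqrt (h v v)) *\<^sub>R v"
    have u: "u \<in> V" "h u u = 1"
      using v V pos[OF v] by (auto simp: u_def scale subspace_scale)
    define V' where "V' = {x \<in> V. h x u = 0}"
    have V': "subspace V'" "V' \<subseteq> V" unfolding V'_def
      using V scale[of u u 0] by (auto intro!: subspaceI simp: subspace_0 subspace_add subspace_scale add scale u)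
    have "u \<notin> V'" using u by (simp add: V'_def)
    then have "dim V' < dim V"
      using V' V u by (intro dim_psubset) (metis psubsetI span_eq_iff)
    moreover have "symmetric_bilinear_on V' h"
      using h V'(2) unfolding symmetric_bilinear_on_def by blast
    ultimately obtain B where B: "orthonormal_basis h V' B"
      using less.hyps[of V'] V' pos by blast
    have BV': "B \<subseteq> V'" by (rule orthonormal_basis_subset[OF B])
    have orth: "h x y = 0" if "x \<in> insert u B" "y \<in> insert u B" "x \<noteq> y" for x y
    proof -
      have bu: "b \<in> V" "h b u = 0" if "b \<in> B" for b
        using that BV' unfolding V'_def by auto
      then have "h u b = 0" if "b \<in> B" for b
        using that h u(1) unfolding symmetric_bilinear_on_def by metis
      then show ?thesis using that bu B unfolding orthonormal_basis_def by auto
    qed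
    have unit: "\<bar>h x x\<bar> = 1" if "x \<in> insert u B" for x
      using that B u unfolding orthonormal_basis_def by auto
    have sub: "insert u B \<subseteq> V" using BV' V' u by auto
    have "V \<subseteq> span (insert u B)"
    proof
      fix x assume x: "x \<in> V"
      have "h (x + (- h x u) *\<^sub>R u) u = 0" using x u V by (simp only: add scale subspace_scale)
      then have "x + (- h x u) *\<^sub>R u \<in> V'" unfolding V'_def using x u V
        by (simp only: mem_Collect_eq subspace_add subspace_scale)
      then have "x - h x u *\<^sub>R u \<in> span B" using B unfolding orthonormal_basis_def by simp
      then show "x \<in> span (insert u B)" unfolding span_insert by blast
    qed
    moreover have "span (insert u B) \<subseteq> V" using sub V by (rule span_minimal)
    ultimately have "orthonormal_basis h V (insert u B)"
      unfolding orthonormal_basis_def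
      using orthonormal_independent[OF h V sub unit orth] unit orth by blast
    then show ?thesis by blast
  qed
qed

section \<open>Left-invariant derivatives of holomorphic functions\<close>

text \<open>A curve-free counterpart of \<open>lie_deriv\<close> on the ambient group.
  Differentiating in the chart at the identity treats all directions \<open>v\<close> at once, so
  for holomorphic \<open>F\<close> complex linearity in \<open>v\<close> is that of a
  derivative.\<close>

definition left_deriv ::
  "('g::{t2_space, second_countable_topology}, 'd::finite) lie_data \<Rightarrow>
    complex ^ 'd \<Rightarrow> ('g \<Rightarrow> complex) \<Rightarrow> 'g \<Rightarrow> complex" where
  "left_deriv L v F g =
    frechet_derivative (\<lambda>w. F (g \<otimes>\<^bsub>L\<^esub> inv_into (fst (chart0 L)) (snd (chart0 L)) w))
      (at (snd (chart0 L) \<one>\<^bsub>L\<^esub>)) v"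

locale complex_group =
  fixes L :: "('g::{t2_space, second_countable_topology}, 'd::finite) lie_data" (structure)
  assumes complex_lie_group: "complex_lie_group L"
begin

sublocale group L
  using complex_lie_group unfolding complex_lie_group_def by blast

lemma carrier [simp]: "carrier L = UNIV"
  using complex_lie_group unfolding complex_lie_group_def by blast

abbreviation "D0 \<equiv> fst (chart0 L)"
abbreviation "\<xi>0 \<equiv> snd (chart0 L)"

lemma atlas: "complex_atlas (charts L)"
  using complex_lie_group unfolding complex_lie_group_def by blast

lemma chart0: "(D0, \<xi>0) \<in> charts L" "\<one> \<in> D0"
  using complex_lie_group unfolding complex_lie_group_def by auto

lemma continuous_mult: "continuous_on UNIV (\<lambda>(x, y). x \<otimes> y)"
  using complex_lie_group unfolding complex_lie_group_def by blast

lemma continuous_inverse: "continuous_on UNIV (\<lambda>x. inv x)"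
  using complex_lie_group unfolding complex_lie_group_def by blast

lemma continuous_on_mult:
  "continuous_on S f \<Longrightarrow> continuous_on S g \<Longrightarrow> continuous_on S (\<lambda>z. f z \<otimes> g z)"
  using continuous_on_compose2[OF continuous_mult, of S "\<lambda>z. (f z, g z)"]
  by (auto intro: continuous_on_Pair)

lemma chart_exists:
  obtains D \<xi> where "(D, \<xi>) \<in> charts L" "x \<in> D"
proof -
  have "x \<in> \<Union>(fst ` charts L)" using atlas unfolding complex_atlas_def by auto
  then show thesis using that by auto
qed

context
  fixes D \<xi> assumes chart: "(D, \<xi>) \<in> charts L"
begin

lemma chart_open: "open D" "open (\<xi> ` D)"
  and chart_homeomorphism: "homeomorphism D (\<xi> ` D) \<xi> (inv_into D \<xi>)"
  using atlas chart unfolding complex_atlas_def by auto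

lemma chart_continuous: "continuous_on D \<xi>" "continuous_on (\<xi> ` D) (inv_into D \<xi>)"
  using chart_homeomorphism unfolding homeomorphism_def by auto

lemma chart_inverse [simp]: "x \<in> D \<Longrightarrow> inv_into D \<xi> (\<xi> x) = x"
  using chart_homeomorphism unfolding homeomorphism_def by auto

lemma chart_image_eq: "\<xi> ` (D \<inter> S) = {z \<in> \<xi> ` D. inv_into D \<xi> z \<in> S}"
  by auto

lemma chart_image_open: "open S \<Longrightarrow> open (\<xi> ` (D \<inter> S))"
  using continuous_open_preimage[OF chart_continuous(2) chart_open(2), of S]
  unfolding chart_image_eq by (auto simp: Int_def vimage_def)

end

lemma holomorphic_funD:
  "holomorphic_fun L F S \<Longrightarrow> (D, \<xi>) \<in> charts L \<Longrightarrow> hol_on (*s) (*) (F \<circ> inv_into D \<xi>) (\<xi> ` (D \<inter> S))"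
  unfolding holomorphic_fun_def by auto

lemma holomorphic_fun_continuous:
  assumes "holomorphic_fun L F S" "open S"
  shows "continuous_on S F"
proof (intro continuous_at_imp_continuous_on ballI)
  fix x assume x: "x \<in> S"
  obtain D \<xi> where c: "(D, \<xi>) \<in> charts L" "x \<in> D" by (rule chart_exists)
  have "continuous_on (D \<inter> S) ((F \<circ> inv_into D \<xi>) \<circ> \<xi>)"
    by (intro continuous_on_compose continuous_on_subset[OF chart_continuous(1)[OF c(1)]]
        hol_on_continuous[OF holomorphic_funD[OF assms(1) c(1)]]) auto
  then have "continuous_on (D \<inter> S) F"
    by (rule continuous_on_eq) (simp add: chart_inverse[OF c(1)])
  then show "isCont F x"
    using continuous_on_eq_continuous_at[of "D \<inter> S"] x c(2) chart_open(1)[OF c(1)] assms(2) by blast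
qed

lemma holomorphic_fun_cong:
  assumes "holomorphic_fun L F S" "open S" "\<And>x. x \<in> S \<Longrightarrow> F x = F' x"
  shows "holomorphic_fun L F' S"
  unfolding holomorphic_fun_def
proof (clarify)
  fix D \<xi> assume c: "(D, \<xi>) \<in> charts L"
  show "hol_on (*s) (*) (F' \<circ> inv_into D \<xi>) (\<xi> ` (D \<inter> S))"
    by (rule hol_on_cong[OF holomorphic_funD[OF assms(1) c] chart_image_open[OF c assms(2)]])
      (auto simp: chart_inverse[OF c] assms(3))
qed

lemma holomorphic_fun_add:
  "holomorphic_fun L F S \<Longrightarrow> holomorphic_fun L F' S \<Longrightarrow> holomorphic_fun L (\<lambda>x. F x + F' x) S"
  and holomorphic_fun_mult:
  "holomorphic_fun L F S \<Longrightarrow> holomorphic_fun L F' S \<Longrightarrow> holomorphic_fun L (\<lambda>x. F x * F' x) S"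
  and holomorphic_fun_const: "holomorphic_fun L (\<lambda>_. a) S"
  using hol_on_add[of "(*s)" "F \<circ> inv_into _ _" _ "F' \<circ> inv_into _ _"]
    hol_on_mult[of "(*s)" "F \<circ> inv_into _ _" _ "F' \<circ> inv_into _ _"]
    hol_on_const[OF complex_scaling_mult]
  unfolding holomorphic_fun_def o_def by fast+

lemma holomorphic_fun_sum:
  assumes "\<And>i. i \<in> I \<Longrightarrow> holomorphic_fun L (F i) S"
  shows "holomorphic_fun L (\<lambda>x. \<Sum>i\<in>I. F i x) S"
  using assms
  by (induction I rule: infinite_finite_induct) (auto intro: holomorphic_fun_add holomorphic_fun_const)

text \<open>The domain of multiplication in charts used by \<open>complex_lie_group\<close>, with an
  arbitrary \<open>S\<close> in place of the third chart domain, so that functions given on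
  \<open>S\<close> can be pulled back.\<close>

definition mult_dom where
  "mult_dom D1 \<xi>1 D2 \<xi>2 S = {(\<xi>1 x, \<xi>2 y) | x y. x \<in> D1 \<and> y \<in> D2 \<and> x \<otimes> y \<in> S}"

lemma mult_dom_open:
  assumes "(D1, \<xi>1) \<in> charts L" "(D2, \<xi>2) \<in> charts L" "open S"
  shows "open (mult_dom D1 \<xi>1 D2 \<xi>2 S)"
proof -
  let ?m = "\<lambda>p. inv_into D1 \<xi>1 (fst p) \<otimes> inv_into D2 \<xi>2 (snd p)"
  have "continuous_on (\<xi>1 ` D1 \<times> \<xi>2 ` D2) ?m"
    by (intro continuous_on_mult continuous_on_compose2[OF chart_continuous(2)] continuous_intros assms) auto
  from continuous_open_preimage[OF this open_Times assms(3)]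
  have "open ((\<xi>1 ` D1 \<times> \<xi>2 ` D2) \<inter> ?m -` S)" using chart_open assms by blast
  also have "(\<xi>1 ` D1 \<times> \<xi>2 ` D2) \<inter> ?m -` S = mult_dom D1 \<xi>1 D2 \<xi>2 S"
    unfolding mult_dom_def by (auto simp: chart_inverse[OF assms(1)] chart_inverse[OF assms(2)]) blast
  finally show ?thesis .
qed

lemma mult_hol:
  assumes "(D1, \<xi>1) \<in> charts L" "(D2, \<xi>2) \<in> charts L" "(D3, \<xi>3) \<in> charts L"
  shows "hol_on scale_pair (*s)
         (\<lambda>(z, w). \<xi>3 (inv_into D1 \<xi>1 z \<otimes> inv_into D2 \<xi>2 w)) (mult_dom D1 \<xi>1 D2 \<xi>2 D3)"
  using complex_lie_group assms unfolding complex_lie_group_def mult_dom_def by blast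

lemma inverse_hol:
  assumes "(D1, \<xi>1) \<in> charts L" "(D2, \<xi>2) \<in> charts L"
  shows "hol_on (*s) (*s) (\<lambda>z. \<xi>2 (inv (inv_into D1 \<xi>1 z))) {\<xi>1 x | x. x \<in> D1 \<and> inv x \<in> D2}"
  using complex_lie_group assms unfolding complex_lie_group_def by blast

text \<open>Near each point one factors through a chart around the product. Joint holomorphy in both
  factors later allows differentiating in one and staying holomorphic in the other.\<close>

lemma holomorphic_fun_mult_pullback:
  assumes c1: "(D1, \<xi>1) \<in> charts L" and c2: "(D2, \<xi>2) \<in> charts L"
    and F: "holomorphic_fun L F S" and S: "open S"
  shows "hol_on scale_pair (*)
    (\<lambda>(z, w). F (inv_into D1 \<xi>1 z \<otimes> inv_into D2 \<xi>2 w)) (mult_dom D1 \<xi>1 D2 \<xi>2 S)"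
  unfolding hol_on_def
proof
  fix p assume "p \<in> mult_dom D1 \<xi>1 D2 \<xi>2 S"
  then obtain x y where p: "p = (\<xi>1 x, \<xi>2 y)" "x \<in> D1" "y \<in> D2" "x \<otimes> y \<in> S"
    unfolding mult_dom_def by auto
  obtain D3 \<xi>3 where c3: "(D3, \<xi>3) \<in> charts L" "x \<otimes> y \<in> D3" by (rule chart_exists)
  let ?Q = "mult_dom D1 \<xi>1 D2 \<xi>2 (D3 \<inter> S)"
  have "hol_on scale_pair (*)
      ((F \<circ> inv_into D3 \<xi>3) \<circ> (\<lambda>(z, w). \<xi>3 (inv_into D1 \<xi>1 z \<otimes> inv_into D2 \<xi>2 w))) ?Q"
  proof (rule hol_on_compose[OF hol_on_subset[OF mult_hol[OF c1 c2 c3(1)]] holomorphic_funD[OF F c3(1)]])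
    show "?Q \<subseteq> mult_dom D1 \<xi>1 D2 \<xi>2 D3" unfolding mult_dom_def by blast
    show "(\<lambda>(z, w). \<xi>3 (inv_into D1 \<xi>1 z \<otimes> inv_into D2 \<xi>2 w)) ` ?Q \<subseteq> \<xi>3 ` (D3 \<inter> S)"
      unfolding mult_dom_def by (auto simp: chart_inverse[OF c1] chart_inverse[OF c2])
  qed
  then have "hol_on scale_pair (*) (\<lambda>(z, w). F (inv_into D1 \<xi>1 z \<otimes> inv_into D2 \<xi>2 w)) ?Q"
    by (rule hol_on_cong[OF _ mult_dom_open[OF c1 c2]])
      (use S chart_open(1)[OF c3(1)] in
        \<open>auto simp: mult_dom_def chart_inverse[OF c1] chart_inverse[OF c2] chart_inverse[OF c3(1)]\<close>)
  moreover have "p \<in> ?Q" unfolding mult_dom_def using p c3 by blast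
  ultimately show "\<exists>f'. ((\<lambda>(z, w). F (inv_into D1 \<xi>1 z \<otimes> inv_into D2 \<xi>2 w)) has_derivative f') (at p) \<and>
      (\<forall>c v. f' (scale_pair c v) = c * f' v)"
    unfolding hol_on_def by blast
qed

lemma left_translate_hol:
  assumes F: "holomorphic_fun L F S" "open S" and g: "g \<in> S"
  shows "((\<lambda>w. F (g \<otimes> inv_into D0 \<xi>0 w)) has_derivative (\<lambda>v. left_deriv L v F g)) (at (\<xi>0 \<one>))"
    and "left_deriv L (c *s v) F g = c * left_deriv L v F g"
proof -
  obtain D \<xi> where c: "(D, \<xi>) \<in> charts L" "g \<in> D" by (rule chart_exists)
  let ?\<Phi> = "\<lambda>(z, w). F (inv_into D \<xi> z \<otimes> inv_into D0 \<xi>0 w)"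
  have "hol_on (*s) scale_pair (\<lambda>w. (\<xi> g, w)) {\<xi>0 \<one>}"
    by (intro hol_on_pair hol_on_const complex_scaling_vec hol_on_linear bounded_linear_ident) simp
  moreover have "(\<lambda>w. (\<xi> g, w)) ` {\<xi>0 \<one>} \<subseteq> mult_dom D \<xi> D0 \<xi>0 S"
    using c chart0 g unfolding mult_dom_def by force
  ultimately have "hol_on (*s) (*) (?\<Phi> \<circ> (\<lambda>w. (\<xi> g, w))) {\<xi>0 \<one>}"
    by (rule hol_on_compose[OF _ holomorphic_fun_mult_pullback[OF c(1) chart0(1) F]])
  moreover have "?\<Phi> \<circ> (\<lambda>w. (\<xi> g, w)) = (\<lambda>w. F (g \<otimes> inv_into D0 \<xi>0 w))"
    by (auto simp: chart_inverse[OF c])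
  ultimately have h: "hol_on (*s) (*) (\<lambda>w. F (g \<otimes> inv_into D0 \<xi>0 w)) {\<xi>0 \<one>}" by simp
  show "((\<lambda>w. F (g \<otimes> inv_into D0 \<xi>0 w)) has_derivative (\<lambda>v. left_deriv L v F g)) (at (\<xi>0 \<one>))"
    using hol_on_derivative(1)[OF h] unfolding left_deriv_def by simp
  show "left_deriv L (c *s v) F g = c * left_deriv L v F g"
    using hol_on_derivative(2)[OF h] unfolding left_deriv_def by simp
qed

lemma left_deriv_linear:
  assumes F: "holomorphic_fun L F S" "open S" and g: "g \<in> S"
  shows "linear (\<lambda>v. left_deriv L v F g)"
  using has_derivative_linear[OF left_translate_hol(1)[OF assms]] .

text \<open>In charts, \<open>left_deriv\<close> is the partial derivative of the two-variable
  pullback in direction \<open>(0, v)\<close>, restricted to second coordinate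
  \<open>\<xi>0 \<one>\<close>; so \<open>hol_on_directional_derivative\<close> applies.\<close>

lemma left_deriv_holomorphic:
  assumes F: "holomorphic_fun L F S" "open S"
  shows "holomorphic_fun L (left_deriv L v F) S"
  unfolding holomorphic_fun_def
proof clarify
  fix D \<xi> assume c: "(D, \<xi>) \<in> charts L"
  let ?\<Phi> = "\<lambda>(z, w). F (inv_into D \<xi> z \<otimes> inv_into D0 \<xi>0 w)"
  let ?Q = "mult_dom D \<xi> D0 \<xi>0 S"
  have \<Phi>: "hol_on scale_pair (*) ?\<Phi> ?Q"
    by (rule holomorphic_fun_mult_pullback[OF c chart0(1) F])
  have Q: "open ?Q" by (rule mult_dom_open[OF c chart0(1) F(2)])
  have mem: "(z, \<xi>0 \<one>) \<in> ?Q" if "z \<in> \<xi> ` (D \<inter> S)" for z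
    using that chart0 unfolding mult_dom_def by force
  have "hol_on (*s) (*) ((\<lambda>p. frechet_derivative ?\<Phi> (at p) (0, v)) \<circ> (\<lambda>z. (z, \<xi>0 \<one>))) (\<xi> ` (D \<inter> S))"
    using mem
    by (intro hol_on_compose[OF _ hol_on_directional_derivative[OF \<Phi> complex_scaling_pair Q]]
        hol_on_pair hol_on_const complex_scaling_vec hol_on_linear bounded_linear_ident) auto
  then show "hol_on (*s) (*) (left_deriv L v F \<circ> inv_into D \<xi>) (\<xi> ` (D \<inter> S))"
  proof (rule hol_on_cong[OF _ chart_image_open[OF c F(2)]])
    fix z assume z: "z \<in> \<xi> ` (D \<inter> S)"
    have "((\<lambda>w. (z, w)) has_derivative (\<lambda>w. (0, w))) (at (\<xi>0 \<one>))"
      by (auto intro!: derivative_eq_intros)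
    from diff_chain_at[OF this hol_on_derivative(1)[OF \<Phi> mem[OF z]]]
    have "((\<lambda>w. F (inv_into D \<xi> z \<otimes> inv_into D0 \<xi>0 w)) has_derivative
        (\<lambda>w. frechet_derivative ?\<Phi> (at (z, \<xi>0 \<one>)) (0, w))) (at (\<xi>0 \<one>))"
      by (simp add: o_def)
    from frechet_derivative_at[OF this]
    show "((\<lambda>p. frechet_derivative ?\<Phi> (at p) (0, v)) \<circ> (\<lambda>z. (z, \<xi>0 \<one>))) z =
        (left_deriv L v F \<circ> inv_into D \<xi>) z"
      unfolding left_deriv_def by (metis comp_apply)
  qed
qed

lemma left_deriv_cong:
  assumes F: "holomorphic_fun L F S" "open S" and g: "g \<in> S"
    and eq: "\<And>x. x \<in> S \<Longrightarrow> F x = F' x"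
  shows "left_deriv L v F g = left_deriv L v F' g"
proof -
  have "continuous_on (\<xi>0 ` D0) (\<lambda>w. g \<otimes> inv_into D0 \<xi>0 w)"
    by (intro continuous_on_mult chart_continuous(2)[OF chart0(1)] continuous_intros)
  from continuous_open_preimage[OF this chart_open(2)[OF chart0(1)] F(2)]
  have "open (\<xi>0 ` D0 \<inter> (\<lambda>w. g \<otimes> inv_into D0 \<xi>0 w) -` S)" .
  then have "frechet_derivative (\<lambda>w. F (g \<otimes> inv_into D0 \<xi>0 w)) (at (\<xi>0 \<one>)) =
      frechet_derivative (\<lambda>w. F' (g \<otimes> inv_into D0 \<xi>0 w)) (at (\<xi>0 \<one>))"
    using left_translate_hol(1)[OF F g] g chart0 chart_inverse[OF chart0]
    by (intro frechet_derivative_transform_within_open)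
      (auto simp: differentiable_def eq chart_inverse[OF chart0(1)])
  then show ?thesis unfolding left_deriv_def by simp
qed

lemma left_deriv_const [simp]: "left_deriv L v (\<lambda>_. a) g = 0"
  unfolding left_deriv_def by simp

lemma left_deriv_add:
  assumes F: "holomorphic_fun L F S" "holomorphic_fun L F' S" "open S" and g: "g \<in> S"
  shows "left_deriv L v (\<lambda>x. F x + F' x) g = left_deriv L v F g + left_deriv L v F' g"
  using fun_cong[OF frechet_derivative_at[OF has_derivative_add[OF
    left_translate_hol(1)[OF F(1,3) g] left_translate_hol(1)[OF F(2,3) g]]], of v]
  by (simp add: left_deriv_def)

lemma left_deriv_cmult:
  assumes F: "holomorphic_fun L F S" "open S" and g: "g \<in> S"
  shows "left_deriv L v (\<lambda>x. a * F x) g = a * left_deriv L v F g"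
  using fun_cong[OF frechet_derivative_at[OF has_derivative_mult_right[OF
    left_translate_hol(1)[OF F g]]], of a v]
  by (simp add: left_deriv_def)

text \<open>With \<open>a = b = \<i>\<close> this is the sign change that
  \<open>trace_dual_metric\<close> asks of its bilinear form.\<close>

lemma left_deriv2_scale:
  assumes F: "holomorphic_fun L F S" "open S" and g: "g \<in> S"
  shows "left_deriv L (a *s u) (left_deriv L (b *s v) F) g = a * b * left_deriv L u (left_deriv L v F) g"
proof -
  note h = left_deriv_holomorphic[OF F]
  have "left_deriv L (a *s u) (left_deriv L (b *s v) F) g = a * left_deriv L u (left_deriv L (b *s v) F) g"
    by (rule left_translate_hol(2)[OF h F(2) g])
  also have "left_deriv L u (left_deriv L (b *s v) F) g = left_deriv L u (\<lambda>x. b * left_deriv L v F x) g"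
    by (rule left_deriv_cong[OF h F(2) g]) (rule left_translate_hol(2)[OF F])
  also have "\<dots> = b * left_deriv L u (left_deriv L v F) g"
    by (rule left_deriv_cmult[OF h F(2) g])
  finally show ?thesis by simp
qed

lemma left_deriv2_bilinear:
  assumes F: "holomorphic_fun L F S" "open S" and g: "g \<in> S"
  shows "bilinear (\<lambda>u v. left_deriv L u (left_deriv L v F) g)"
  unfolding bilinear_def
proof (intro conjI allI)
  note h = left_deriv_holomorphic[OF F]
  show "linear (\<lambda>u. left_deriv L u (left_deriv L v F) g)" for v
    by (rule left_deriv_linear[OF h F(2) g])
  show "linear (\<lambda>v. left_deriv L u (left_deriv L v F) g)" for u
  proof (rule linearI)
    fix v w
    have "left_deriv L u (left_deriv L (v + w) F) g =
        left_deriv L u (\<lambda>x. left_deriv L v F x + left_deriv L w F x) g"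
      by (rule left_deriv_cong[OF h F(2) g]) (rule linear_add[OF left_deriv_linear[OF F]])
    then show "left_deriv L u (left_deriv L (v + w) F) g =
        left_deriv L u (left_deriv L v F) g + left_deriv L u (left_deriv L w F) g"
      by (simp add: left_deriv_add[OF h h F(2) g])
  next
    fix r and v :: "complex ^ 'd"
    have "r *\<^sub>R v = of_real r *s v"
      unfolding vec_eq_iff vector_scaleR_component vector_smult_component by (simp add: scaleR_conv_of_real)
    then show "left_deriv L u (left_deriv L (r *\<^sub>R v) F) g = r *\<^sub>R left_deriv L u (left_deriv L v F) g"
      using left_deriv2_scale[OF F g, of 1 u "of_real r" v] by (simp add: scaleR_conv_of_real)
  qed
qed

lemma left_deriv_prod_bilinear:
  assumes F: "holomorphic_fun L F S" "holomorphic_fun L F' S" "open S" and g: "g \<in> S"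
  shows "bilinear (\<lambda>u v. left_deriv L u F g * left_deriv L v F' g)"
  using left_deriv_linear[OF F(1,3) g] left_deriv_linear[OF F(2,3) g]
  unfolding bilinear_def linear_iff by (auto simp: algebra_simps)

text \<open>\<open>curve_in\<close> speaks of differentiability only for the coordinates
  \<open>\<xi>0 \<circ> c\<close>; continuity of \<open>c\<close> at 0 is recovered through the
  inverse chart, as \<open>c\<close> stays in \<open>D0\<close> near 0.\<close>

lemma curve_in_tendsto:
  assumes "curve_in L H v c"
  shows "(c \<longlongrightarrow> \<one>) (at 0)"
    and "\<forall>\<^sub>F t in at 0. c t \<in> H \<inter> D0"
proof -
  have c0: "c 0 = \<one>" and d: "((\<xi>0 \<circ> c) has_vector_derivative v) (at 0)"
    using assms unfolding curve_in_def by auto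
  obtain \<delta> where \<delta>: "\<delta> > 0" "\<And>t. t \<in> {-\<delta><..<\<delta>} \<Longrightarrow> c t \<in> H \<inter> D0"
    using assms unfolding curve_in_def by auto
  have "\<forall>\<^sub>F t in nhds 0. c t \<in> H \<inter> D0"
    using eventually_nhds_in_open[of "{-\<delta><..<\<delta>}" 0] \<delta> by (auto elim!: eventually_mono)
  then show ev': "\<forall>\<^sub>F t in at 0. c t \<in> H \<inter> D0"
    using eventually_nhds_conv_at by blast
  have "((\<xi>0 \<circ> c) \<longlongrightarrow> \<xi>0 \<one>) (at 0)"
    using has_vector_derivative_continuous[OF d] c0 by (simp add: continuous_at o_def)
  moreover have "isCont (inv_into D0 \<xi>0) (\<xi>0 \<one>)"
    using chart_continuous(2)[OF chart0(1)] chart_open(2)[OF chart0(1)] chart0(2)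
    by (simp add: continuous_on_eq_continuous_at)
  ultimately have "((\<lambda>t. inv_into D0 \<xi>0 ((\<xi>0 \<circ> c) t)) \<longlongrightarrow> inv_into D0 \<xi>0 (\<xi>0 \<one>)) (at 0)"
    by (rule isCont_tendsto_compose[rotated])
  then have "((\<lambda>t. inv_into D0 \<xi>0 ((\<xi>0 \<circ> c) t)) \<longlongrightarrow> \<one>) (at 0)"
    using chart_inverse[OF chart0] by simp
  then show "(c \<longlongrightarrow> \<one>) (at 0)"
    by (rule Lim_transform_eventually)
      (use ev' in \<open>auto elim!: eventually_mono simp: chart_inverse[OF chart0(1)]\<close>)
qed

lemma curve_in_left_deriv:
  assumes c: "curve_in L H v c" and F: "holomorphic_fun L F S" "open S" and g: "g \<in> S"
  shows "((\<lambda>t. F (g \<otimes> c t)) has_vector_derivative left_deriv L v F g) (at 0)"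
proof -
  have c0: "c 0 = \<one>" and d: "((\<xi>0 \<circ> c) has_vector_derivative v) (at 0)"
    using c unfolding curve_in_def by auto
  have "((\<lambda>w. F (g \<otimes> inv_into D0 \<xi>0 w)) \<circ> (\<xi>0 \<circ> c) has_vector_derivative left_deriv L v F g) (at 0)"
    by (rule vector_derivative_diff_chain_within[OF d])
      (use left_translate_hol(1)[OF F g] c0 in \<open>auto intro: has_derivative_at_withinI\<close>)
  then show ?thesis
    unfolding has_vector_derivative_def
    by (rule has_derivative_transform_eventually)
      (use curve_in_tendsto(2)[OF c] c0 chart0(2) in
        \<open>auto elim!: eventually_mono simp: chart_inverse[OF chart0(1)]\<close>)
qed

text \<open>A curve in \<open>H\<close> translated by \<open>g\<close> stays in \<open>H\<close>
  because \<open>H\<close> is a subgroup, and near 0 in \<open>S\<close> by continuity; there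
  \<open>f\<close> and \<open>F\<close> agree. All curves give the same value, and \<open>v\<close>
  in the Lie algebra supplies at least one curve, so the definite description has exactly one
  solution.\<close>

lemma lie_deriv_eq_left_deriv:
  assumes H: "subgroup H L" and v: "v \<in> lie_algebra L H"
    and F: "holomorphic_fun L F S" "open S" and eq: "\<And>x. x \<in> H \<inter> S \<Longrightarrow> f x = F x"
    and g: "g \<in> H \<inter> S"
  shows "lie_deriv L H v f g = left_deriv L v F g"
proof -
  have D: "((\<lambda>t. f (g \<otimes> c t)) has_vector_derivative left_deriv L v F g) (at 0)" if c: "curve_in L H v c" for c
  proof -
    have "continuous_on UNIV (\<lambda>x. g \<otimes> x)" by (intro continuous_on_mult continuous_intros)
    then have "isCont (\<lambda>x. g \<otimes> x) \<one>" by (simp add: continuous_on_eq_continuous_at)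
    from isCont_tendsto_compose[OF this curve_in_tendsto(1)[OF c]]
    have "((\<lambda>t. g \<otimes> c t) \<longlongrightarrow> g) (at 0)" by simp
    then have "\<forall>\<^sub>F t in at 0. g \<otimes> c t \<in> S" using g F(2) by (auto dest: topological_tendstoD)
    with curve_in_tendsto(2)[OF c] have "\<forall>\<^sub>F t in at 0. F (g \<otimes> c t) = f (g \<otimes> c t)"
    proof eventually_elim
      case (elim t)
      then show ?case using eq[of "g \<otimes> c t"] subgroup.m_closed[OF H] g by auto
    qed
    moreover have "c 0 = \<one>" using c unfolding curve_in_def by blast
    moreover have "((\<lambda>t. F (g \<otimes> c t)) has_vector_derivative left_deriv L v F g) (at 0)"
      using curve_in_left_deriv[OF c F] g by blast
    ultimately show ?thesis
      unfolding has_vector_derivative_def using eq[OF g] g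
      by (elim has_derivative_transform_eventually) auto
  qed
  obtain c where c: "curve_in L H v c" using v unfolding lie_algebra_def by blast
  show ?thesis unfolding lie_deriv_def
  proof (rule the_equality)
    show "D' = left_deriv L v F g"
      if "\<forall>c. curve_in L H v c \<longrightarrow> ((\<lambda>t. f (g \<otimes> c t)) has_vector_derivative D') (at 0)" for D'
      using that c D vector_derivative_unique_at by blast
  qed (use D in blast)
qed

text \<open>The first derivative again agrees with a holomorphic function on all of
  \<open>H \<inter> S\<close>, so the previous lemma applies to it once more.\<close>

lemma lie_deriv2_eq_left_deriv:
  assumes H: "subgroup H L" and v: "v \<in> lie_algebra L H"
    and F: "holomorphic_fun L F S" "open S" and eq: "\<And>x. x \<in> H \<inter> S \<Longrightarrow> f x = F x"
    and g: "g \<in> H \<inter> S"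
  shows "lie_deriv L H v (lie_deriv L H v f) g = left_deriv L v (left_deriv L v F) g"
  by (rule lie_deriv_eq_left_deriv[OF H v left_deriv_holomorphic[OF F] F(2)
        lie_deriv_eq_left_deriv[OF H v F eq] g])

end

section \<open>The identity theorem on totally real subgroups\<close>

lemma norm_vector_smult: "norm (c *s v) = norm c * norm (v :: complex ^ 'd)"
  by (simp add: norm_vec_def L2_set_def norm_mult power_mult_distrib sum_distrib_left[symmetric] real_sqrt_mult)

context complex_group
begin

text \<open>Write \<open>F x'\<close> as \<open>F (x \<otimes> (inv x \<otimes> x'))\<close> and
  differentiate at \<open>x' = x\<close>, where the second factor is the identity. So
  \<open>b w z\<close> is the chart vector \<open>w\<close> at \<open>z\<close> carried to the
  identity by left translation: the Maurer-Cartan form in coordinates. It does not depend on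
  \<open>F\<close>; its continuity enters the linear system in
  \<open>flat_imp_zero_nearby\<close>.\<close>

lemma chart_derivative_left_deriv:
  assumes c: "(D, \<xi>) \<in> charts L" and g: "g \<in> D"
  obtains N b where "open N" "\<xi> g \<in> N" "N \<subseteq> \<xi> ` D" "\<And>w. continuous_on N (b w)"
    "\<And>F S z w. holomorphic_fun L F S \<Longrightarrow> open S \<Longrightarrow> z \<in> N \<Longrightarrow> inv_into D \<xi> z \<in> S \<Longrightarrow>
      frechet_derivative (F \<circ> inv_into D \<xi>) (at z) w = left_deriv L (b w z) F (inv_into D \<xi> z)"
proof -
  obtain D1 \<xi>1 where c1: "(D1, \<xi>1) \<in> charts L" "inv g \<in> D1" by (rule chart_exists)
  \<comment> \<open>\<open>N\<close> is cut down so that inverses stay in the single chart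
    \<open>\<xi>1\<close>; \<open>\<iota>\<close> is inversion and \<open>\<mu>\<close>
    multiplication in coordinates, the latter with values in the chart at the identity.\<close>
  define N where "N = \<xi> ` (D \<inter> (\<lambda>x. inv x) -` D1)"
  define \<iota> where "\<iota> z = \<xi>1 (inv (inv_into D \<xi> z))" for z
  define \<mu> where "\<mu> = (\<lambda>(z, w). \<xi>0 (inv_into D1 \<xi>1 z \<otimes> inv_into D \<xi> w))"
  let ?Q = "mult_dom D1 \<xi>1 D \<xi> D0"
  define b where "b w z = frechet_derivative \<mu> (at (\<iota> z, z)) (0, w)" for w z
  have "open ((\<lambda>x. inv x) -` D1)"
    by (rule open_vimage[OF chart_open(1)[OF c1(1)] continuous_inverse])
  then have N: "open N" "\<xi> g \<in> N" "N \<subseteq> \<xi> ` D"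
    unfolding N_def using c1(2) g chart_image_open[OF c] by auto
  have \<mu>: "hol_on scale_pair (*s) \<mu> ?Q" unfolding \<mu>_def by (rule mult_hol[OF c1(1) c chart0(1)])
  have Q: "open ?Q" by (rule mult_dom_open[OF c1(1) c chart_open(1)[OF chart0(1)]])
  have mem: "(\<iota> z, z) \<in> ?Q" if z: "z \<in> N" for z
  proof -
    obtain x where "z = \<xi> x" "x \<in> D" "inv x \<in> D1" using z unfolding N_def by auto
    then show ?thesis unfolding mult_dom_def \<iota>_def using chart0 chart_inverse[OF c] by force
  qed
  have "N = {\<xi> x | x. x \<in> D \<and> inv x \<in> D1}" unfolding N_def by auto
  then have \<iota>: "continuous_on N \<iota>"
    using hol_on_continuous[OF inverse_hol[OF c c1(1)]] unfolding \<iota>_def by simp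
  \<comment> \<open>Componentwise, since \<open>hol_on_continuous_derivative\<close> concerns
    complex-valued functions.\<close>
  have "continuous_on N (\<lambda>z. b w z $ l)" for w l
  proof -
    have l: "hol_on (*s) (*) (\<lambda>v :: complex ^ 'd. v $ l) UNIV"
      by (rule hol_on_linear) (auto intro: bounded_linear_vec_nth)
    have h: "hol_on scale_pair (*) ((\<lambda>v. v $ l) \<circ> \<mu>) ?Q" by (rule hol_on_compose[OF \<mu> l]) simp
    have "continuous_on N (\<lambda>z. frechet_derivative ((\<lambda>v. v $ l) \<circ> \<mu>) (at (\<iota> z, z)) (0, w))"
      by (rule continuous_on_compose2[OF hol_on_continuous_derivative[OF h complex_scaling_pair Q]])
        (use mem in \<open>auto intro!: continuous_intros \<iota>\<close>)
    then show ?thesis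
    proof (rule continuous_on_eq)
      fix z assume z: "z \<in> N"
      have "((\<lambda>v. v $ l) \<circ> \<mu> has_derivative (\<lambda>v. v $ l) \<circ> frechet_derivative \<mu> (at (\<iota> z, z))) (at (\<iota> z, z))"
        by (rule diff_chain_at[OF hol_on_derivative(1)[OF \<mu> mem[OF z]]])
          (rule bounded_linear_imp_has_derivative[OF bounded_linear_vec_nth])
      from fun_cong[OF frechet_derivative_at[OF this], of "(0, w)"]
      show "frechet_derivative ((\<lambda>v. v $ l) \<circ> \<mu>) (at (\<iota> z, z)) (0, w) = b w z $ l"
        unfolding b_def by simp
    qed
  qed
  then have "continuous_on N (\<lambda>z. \<chi> l. b w z $ l)" for w
    by (rule continuous_on_vec_lambda)
  then have b: "continuous_on N (b w)" for w by simp
  have "frechet_derivative (F \<circ> inv_into D \<xi>) (at z) w = left_deriv L (b w z) F (inv_into D \<xi> z)"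
    if F: "holomorphic_fun L F S" "open S" and z: "z \<in> N" "inv_into D \<xi> z \<in> S" for F S z w
  proof -
    let ?x = "inv_into D \<xi> z"
    have xD: "?x \<in> D" "inv ?x \<in> D1" "\<xi> ?x = z" using z(1) chart_inverse[OF c] unfolding N_def by auto
    have \<mu>z: "\<mu> (\<iota> z, z) = \<xi>0 \<one>"
      unfolding \<mu>_def \<iota>_def using chart_inverse[OF c1(1) xD(2)] by simp
    have "((\<lambda>z'. (\<iota> z, z')) has_derivative (\<lambda>h. (0, h))) (at z)"
      by (auto intro!: derivative_eq_intros)
    from diff_chain_at[OF this hol_on_derivative(1)[OF \<mu> mem[OF z(1)]]]
    have "((\<lambda>z'. \<mu> (\<iota> z, z')) has_derivative (\<lambda>h. b h z)) (at z)"
      unfolding b_def by (simp add: o_def)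
    from has_derivative_compose[OF this] left_translate_hol(1)[OF F z(2)]
    have "((\<lambda>z'. F (?x \<otimes> inv_into D0 \<xi>0 (\<mu> (\<iota> z, z')))) has_derivative
        (\<lambda>h. left_deriv L (b h z) F ?x)) (at z)"
      unfolding \<mu>z by blast
    then have "(F \<circ> inv_into D \<xi> has_derivative (\<lambda>h. left_deriv L (b h z) F ?x)) (at z)"
    proof (rule has_derivative_transform_within_open)
      \<comment> \<open>These are the \<open>z'\<close> whose point \<open>x'\<close> has
        \<open>inv ?x \<otimes> x'\<close> in \<open>D0\<close>, where the inverse chart undoes
        \<open>\<xi>0\<close>.\<close>
      show "open ((\<lambda>z'. (\<iota> z, z')) -` ?Q)"
        by (intro open_vimage[OF Q] continuous_intros)
      show "z \<in> (\<lambda>z'. (\<iota> z, z')) -` ?Q" using mem[OF z(1)] by simp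
    next
      fix z' assume "z' \<in> (\<lambda>z'. (\<iota> z, z')) -` ?Q"
      then obtain y y' where y: "\<iota> z = \<xi>1 y" "z' = \<xi> y'" "y \<in> D1" "y' \<in> D" "y \<otimes> y' \<in> D0"
        unfolding mult_dom_def by auto
      have "y = inv ?x" using y(1,3) xD(2) chart_inverse[OF c1(1)] unfolding \<iota>_def by metis
      then have "\<mu> (\<iota> z, z') = \<xi>0 (inv ?x \<otimes> y')" "inv ?x \<otimes> y' \<in> D0"
        unfolding \<mu>_def using y chart_inverse[OF c1(1)] chart_inverse[OF c] by auto
      then show "F (?x \<otimes> inv_into D0 \<xi>0 (\<mu> (\<iota> z, z'))) = (F \<circ> inv_into D \<xi>) z'"
        using y chart_inverse[OF chart0(1)] chart_inverse[OF c] by (simp add: m_assoc[symmetric])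
    qed
    from fun_cong[OF frechet_derivative_at[OF this], of w] show ?thesis by simp
  qed
  with N b show thesis by (intro that[of N b])
qed

lemma left_deriv_basis_expansion:
  assumes F: "holomorphic_fun L F S" "open S" and g: "g \<in> S"
  shows "left_deriv L v F g = (\<Sum>l\<in>UNIV. v $ l * left_deriv L (axis l 1) F g)"
proof -
  have "left_deriv L v F g = left_deriv L (\<Sum>l\<in>UNIV. v $ l *s axis l 1) F g"
    by (simp add: basis_expansion)
  also have "\<dots> = (\<Sum>l\<in>UNIV. left_deriv L (v $ l *s axis l 1) F g)"
    by (rule linear_sum[OF left_deriv_linear[OF assms]])
  finally show ?thesis by (simp add: left_translate_hol(2)[OF assms])
qed

lemma iterated_left_deriv_holomorphic:
  assumes "holomorphic_fun L F S" "open S"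
  shows "holomorphic_fun L (foldr (left_deriv L) vs F) S"
  using assms by (induction vs) (auto intro: left_deriv_holomorphic)

text \<open>On the complex line from \<open>\<xi> g\<close> to \<open>\<xi> x\<close>,
  \<open>chart_derivative_left_deriv\<close> expresses the derivative of each iterated derivative
  through those with one more direction in front. With lists of directions as indices this is the
  system of \<open>linear_ode_family_zero\<close>, and \<open>flat\<close> is its initial
  condition.\<close>

lemma flat_imp_zero_nearby:
  assumes F: "holomorphic_fun L F S" "open S" and g: "g \<in> S"
    and flat: "\<And>vs. foldr (left_deriv L) vs F g = 0"
  obtains N where "open N" "g \<in> N" "\<And>x vs. x \<in> N \<Longrightarrow> foldr (left_deriv L) vs F x = 0"
proof -
  obtain D \<xi> where c: "(D, \<xi>) \<in> charts L" "g \<in> D" by (rule chart_exists)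
  let ?x = "inv_into D \<xi>"
  obtain N b where N: "open N" "\<xi> g \<in> N" "N \<subseteq> \<xi> ` D" and b: "\<And>w. continuous_on N (b w)"
    and Nb: "\<And>F S z w. holomorphic_fun L F S \<Longrightarrow> open S \<Longrightarrow> z \<in> N \<Longrightarrow> ?x z \<in> S \<Longrightarrow>
      frechet_derivative (F \<circ> ?x) (at z) w = left_deriv L (b w z) F (?x z)"
    using chart_derivative_left_deriv[OF c] by metis
  have "open (N \<inter> \<xi> ` (D \<inter> S))" "\<xi> g \<in> N \<inter> \<xi> ` (D \<inter> S)"
    using N chart_image_open[OF c(1) F(2)] c(2) g by auto
  then obtain \<epsilon> where \<epsilon>: "\<epsilon> > 0" "ball (\<xi> g) \<epsilon> \<subseteq> N \<inter> \<xi> ` (D \<inter> S)" by (rule openE)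
  let ?P = "\<lambda>vs. foldr (left_deriv L) vs F"
  have P: "holomorphic_fun L (?P vs) S" for vs by (rule iterated_left_deriv_holomorphic[OF F])
  have zero: "?P vs x = 0" if x: "x \<in> D \<inter> \<xi> -` ball (\<xi> g) \<epsilon>" for x vs
  proof -
    define w where "w = \<xi> x - \<xi> g"
    \<comment> \<open>The parameter disc must contain 1, which corresponds to \<open>x\<close>,
      while the line stays in the ball: \<open>\<epsilon> / norm w\<close> is the largest such
      radius, and for \<open>w = 0\<close> any number above 1 would do.\<close>
    define \<rho> where "\<rho> = (if w = 0 then 2 else \<epsilon> / norm w)"
    have w: "norm w < \<epsilon>" using x unfolding w_def by (simp add: dist_norm norm_minus_commute)
    have \<rho>: "1 < \<rho>" using w unfolding \<rho>_def by (simp add: field_simps)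
    have ball: "\<xi> g + t *s w \<in> ball (\<xi> g) \<epsilon>" if "norm t < \<rho>" for t
      using that \<epsilon>(1) unfolding \<rho>_def
      by (cases "w = 0") (auto simp: dist_norm norm_vector_smult field_simps)
    have inS: "?x (\<xi> g + t *s w) \<in> S" "\<xi> g + t *s w \<in> N" "\<xi> g + t *s w \<in> \<xi> ` (D \<inter> S)" if "norm t < \<rho>" for t
      using ball[OF that] \<epsilon>(2) chart_inverse[OF c(1)] by (auto simp: subset_iff)
    have "(\<lambda>t. ?P vs (?x (\<xi> g + t *s w))) 1 = 0"
    proof (rule linear_ode_family_zero[where p = "\<lambda>vs t. ?P vs (?x (\<xi> g + t *s w))" and R = \<rho>
          and b = "\<lambda>l t. b w (\<xi> g + t *s w) $ l" and \<sigma> = "\<lambda>l vs. axis l 1 # vs"])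
      fix vs and t :: complex assume t: "norm t < \<rho>"
      have "((\<lambda>t. (?P vs \<circ> ?x) (\<xi> g + t *s w)) has_field_derivative
          frechet_derivative (?P vs \<circ> ?x) (at (\<xi> g + t *s w)) w) (at t)"
        by (rule hol_on_line[OF holomorphic_funD[OF P c(1)] complex_scaling_vec inS(3)[OF t]])
      also have "frechet_derivative (?P vs \<circ> ?x) (at (\<xi> g + t *s w)) w =
          left_deriv L (b w (\<xi> g + t *s w)) (?P vs) (?x (\<xi> g + t *s w))"
        by (rule Nb[OF P F(2) inS(2)[OF t] inS(1)[OF t]])
      also have "\<dots> = (\<Sum>l\<in>UNIV. b w (\<xi> g + t *s w) $ l * ?P (axis l 1 # vs) (?x (\<xi> g + t *s w)))"
        unfolding foldr.simps comp_apply by (rule left_deriv_basis_expansion[OF P F(2) inS(1)[OF t]])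
      finally show "((\<lambda>t. ?P vs (?x (\<xi> g + t *s w))) has_field_derivative
          (\<Sum>l\<in>UNIV. b w (\<xi> g + t *s w) $ l * ?P (axis l 1 # vs) (?x (\<xi> g + t *s w)))) (at t)"
        unfolding comp_apply .
    next
      fix l
      show "continuous_on (ball 0 \<rho>) (\<lambda>t. b w (\<xi> g + t *s w) $ l)"
        by (intro continuous_intros continuous_on_compose2[OF b]
            bounded_linear.continuous_on[OF complex_scaling_bounded_linear[OF complex_scaling_vec]])
          (use inS in auto)
    next
      show "?P vs (?x (\<xi> g + 0 *s w)) = 0" for vs
        using flat chart_inverse[OF c] by simp
    qed (use \<rho> in auto)
    then show ?thesis using x chart_inverse[OF c(1)] by (simp add: w_def)
  qed
  have "open (D \<inter> \<xi> -` ball (\<xi> g) \<epsilon>)"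
    by (intro continuous_open_preimage chart_continuous[OF c(1)] chart_open[OF c(1)]) simp
  then show thesis using that[of "D \<inter> \<xi> -` ball (\<xi> g) \<epsilon>"] zero c(2) \<epsilon>(1) by auto
qed

text \<open>At a point of \<open>U\<close>, derivatives along the Lie algebra of \<open>U\<close>
  see only values on \<open>U\<close>; \<open>gen\<close> and complex linearity reach the remaining
  directions. Since every component of \<open>S\<close> meets \<open>U\<close>, an open and closed
  set containing \<open>U \<inter> S\<close> is all of \<open>S\<close>.\<close>

lemma vanishing_on_totally_real_subgroup:
  assumes F: "holomorphic_fun L F S" "open S"
    and U: "subgroup U L" and gen: "\<And>z. \<exists>u\<in>lie_algebra L U. \<exists>u'\<in>lie_algebra L U. z = u + \<i> *s u'"
    and comp: "\<forall>C\<in>components S. C \<inter> U \<noteq> {}"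
    and zero: "\<And>g. g \<in> U \<inter> S \<Longrightarrow> F g = 0" and x: "x \<in> S"
  shows "F x = 0"
proof -
  let ?P = "\<lambda>vs. foldr (left_deriv L) vs F"
  have P: "holomorphic_fun L (?P vs) S" for vs by (rule iterated_left_deriv_holomorphic[OF F])
  have PU: "?P vs g = 0" if "g \<in> U \<inter> S" for vs g
    using that
  proof (induction vs arbitrary: g)
    case Nil
    then show ?case using zero by simp
  next
    case (Cons v vs)
    obtain u u' where u: "u \<in> lie_algebra L U" "u' \<in> lie_algebra L U" "v = u + \<i> *s u'"
      using gen by blast
    \<comment> \<open>On \<open>U \<inter> S\<close> both the iterated derivative and the constant 0
      agree with the zero function, so both compute the same \<open>lie_deriv\<close>.\<close>
    have z: "left_deriv L w (?P vs) g = 0" if w: "w \<in> lie_algebra L U" for w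
      using lie_deriv_eq_left_deriv[OF U w P F(2) _ Cons.prems, of "\<lambda>_. 0"] Cons.IH
        lie_deriv_eq_left_deriv[OF U w holomorphic_fun_const F(2) _ Cons.prems, of "\<lambda>_. 0" 0]
      by simp
    have "left_deriv L v (?P vs) g = left_deriv L u (?P vs) g + \<i> * left_deriv L u' (?P vs) g"
      using linear_add[OF left_deriv_linear[OF P F(2)]] left_translate_hol(2)[OF P F(2)] Cons.prems
      unfolding u(3) by auto
    then show ?case using z u by simp
  qed
  define T where "T = {g \<in> S. \<forall>vs. ?P vs g = 0}"
  have "open T"
  proof (subst open_subopen, clarify)
    fix g assume "g \<in> T"
    then have g: "g \<in> S" "\<And>vs. ?P vs g = 0" unfolding T_def by auto
    from flat_imp_zero_nearby[OF F this] obtain N where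
      "open N" "g \<in> N" "\<And>x vs. x \<in> N \<Longrightarrow> ?P vs x = 0" by metis
    then show "\<exists>N. open N \<and> g \<in> N \<and> N \<subseteq> T"
      using F(2) g unfolding T_def by (intro exI[of _ "N \<inter> S"]) auto
  qed
  have "open (S \<inter> ?P vs -` (- {0}))" for vs
    by (rule continuous_open_preimage[OF holomorphic_fun_continuous[OF P F(2)] F(2)]) (simp add: open_Compl)
  then have "open (\<Union>vs. S \<inter> ?P vs -` (- {0}))" by (intro open_UN ballI)
  moreover have "(\<Union>vs. S \<inter> ?P vs -` (- {0})) = S - T" unfolding T_def by auto
  ultimately have "open (S - T)" by (rule subst[rotated])
  obtain C where C: "C \<in> components S" "x \<in> C" by (rule that[OF componentsI[OF x]]) (simp add: x)
  have CS: "connected C" "C \<subseteq> S"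
    using in_components_connected[OF C(1)] in_components_subset[OF C(1)] .
  obtain u where u: "u \<in> C" "u \<in> U" using comp C(1) by blast
  then have "u \<in> T" unfolding T_def using PU CS(2) by auto
  moreover have "T \<inter> C = {} \<or> (S - T) \<inter> C = {}"
    by (rule connectedD[OF CS(1) \<open>open T\<close> \<open>open (S - T)\<close>]) (use CS(2) in auto)
  ultimately have "(S - T) \<inter> C = {}" using u by auto
  then have "x \<in> T" using C(2) CS(2) by auto
  then have "?P [] x = 0" unfolding T_def by blast
  then show ?thesis by simp
qed

end

section \<open>Duality\<close>

text \<open>Gram-Schmidt is applied to \<open>h\<close> on \<open>\<pp>\<close> and to
  \<open>- h\<close> on \<open>\<kk>\<close>; orthogonality of the two pieces lets the bases be
  joined.\<close>

lemma standard_metric_orthonormal_bases: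
  fixes \<gg> :: "'a::euclidean_space set"
  assumes h: "standard_metric \<gg> \<kk> \<pp> h"
    and sub: "subspace \<kk>" "subspace \<pp>" "\<gg> = {y + x | y x. y \<in> \<kk> \<and> x \<in> \<pp>}"
  obtains BK BP where "orthonormal_basis h \<kk> BK" "orthonormal_basis h \<pp> BP"
    "orthonormal_basis h \<gg> (BK \<union> BP)" "BK \<inter> BP = {}"
    "\<And>y. y \<in> BK \<Longrightarrow> h y y = -1" "\<And>x. x \<in> BP \<Longrightarrow> h x x = 1"
proof -
  have sb: "symmetric_bilinear_on \<gg> h" and orth: "\<And>y x. y \<in> \<kk> \<Longrightarrow> x \<in> \<pp> \<Longrightarrow> h y x = 0"
    and neg: "\<And>y. y \<in> \<kk> \<Longrightarrow> y \<noteq> 0 \<Longrightarrow> h y y < 0" and pos: "\<And>x. x \<in> \<pp> \<Longrightarrow> x \<noteq> 0 \<Longrightarrow> h x x > 0"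
    using h unfolding standard_metric_def by blast+
  have kg: "\<kk> \<subseteq> \<gg>" and pg: "\<pp> \<subseteq> \<gg>"
    unfolding sub(3) using sub(1,2) subspace_0 by force+
  have "symmetric_bilinear_on \<kk> (\<lambda>x y. - h x y)" and sbp: "symmetric_bilinear_on \<pp> h"
    using sb kg pg unfolding symmetric_bilinear_on_def by (auto simp: subset_iff)
  from orthonormal_basis_exists[OF this(1) sub(1)] obtain BK
    where "orthonormal_basis (\<lambda>x y. - h x y) \<kk> BK" using neg by auto
  \<comment> \<open>The absolute value in \<open>orthonormal_basis\<close> makes the notion the same
    for \<open>h\<close> and \<open>- h\<close>.\<close>
  then have BK: "orthonormal_basis h \<kk> BK" unfolding orthonormal_basis_def by simp
  obtain BP where BP: "orthonormal_basis h \<pp> BP"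
    using orthonormal_basis_exists[OF sbp sub(2)] pos by auto
  have nz: "0 \<notin> BK" "0 \<notin> BP"
    using BK BP dependent_zero unfolding orthonormal_basis_def by blast+
  have BKk: "BK \<subseteq> \<kk>" and BPp: "BP \<subseteq> \<pp>" using orthonormal_basis_subset BK BP by blast+
  have hK: "h y y = -1" if "y \<in> BK" for y
    using BK neg[of y] that nz BKk unfolding orthonormal_basis_def by fastforce
  have hP: "h x x = 1" if "x \<in> BP" for x
    using BP pos[of x] that nz BPp unfolding orthonormal_basis_def by fastforce
  have o1: "h y x = 0" "h x y = 0" if "y \<in> BK" "x \<in> BP" for x y
  proof -
    have yx: "y \<in> \<kk>" "x \<in> \<pp>" "y \<in> \<gg>" "x \<in> \<gg>" using that BKk BPp kg pg by auto
    then show "h y x = 0" by (simp add: orth)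
    with yx(3,4) show "h x y = 0" using sb unfolding symmetric_bilinear_on_def by metis
  qed
  have o2: "h x y = 0" if "x \<in> BK \<union> BP" "y \<in> BK \<union> BP" "x \<noteq> y" for x y
    using that o1 BK BP unfolding orthonormal_basis_def by blast
  have u2: "\<bar>h x x\<bar> = 1" if "x \<in> BK \<union> BP" for x
    using that hK hP by fastforce
  have sp: "span (BK \<union> BP) = \<gg>"
    using BK BP unfolding span_Un sub(3) orthonormal_basis_def by simp
  have "independent (BK \<union> BP)"
    by (rule orthonormal_independent[OF sb _ _ u2 o2])
      (use sp subspace_span BKk BPp kg pg in \<open>blast+\<close>)
  then have "orthonormal_basis h \<gg> (BK \<union> BP)"
    unfolding orthonormal_basis_def using sp u2 o2 by blast
  moreover have "BK \<inter> BP = {}" using hK hP by fastforce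
  ultimately show thesis using that BK BP hK hP by blast
qed

text \<open>
  Passing from \<open>\<pp>\<close> to \<open>\<i>\<pp>\<close> replaces \<open>\<beta>(X, X)\<close> by \<open>\<beta>(\<i>X, \<i>X) = -\<beta>(X, X)\<close>, and on \<open>\<kk>\<close> the sign of the
  metric changes; hence both sums differ by an overall sign.
\<close>

lemma trace_dual_metric:
  fixes \<gg> \<kk> \<pp> \<uu> :: "(complex ^ 'd) set" and \<beta> :: "complex ^ 'd \<Rightarrow> complex ^ 'd \<Rightarrow> complex"
  assumes h: "standard_metric \<gg> \<kk> \<pp> h"
    and sub: "subspace \<kk>" "subspace \<pp>" "\<gg> = {y + x | y x. y \<in> \<kk> \<and> x \<in> \<pp>}"
    and h': "dual_metric \<uu> \<kk> \<pp> h h'"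
    and real: "\<forall>y\<in>\<kk>. \<forall>x\<in>\<pp>. y = \<i> *s x \<longrightarrow> y = 0"
    and \<beta>: "bilinear \<beta>" "\<And>v. \<beta> (\<i> *s v) (\<i> *s v) = - \<beta> v v"
  shows "(\<Sum>e\<in>some_orthonormal_basis h' \<uu>. of_real (h' e e) * \<beta> e e) =
    - (\<Sum>e\<in>some_orthonormal_basis h \<gg>. of_real (h e e) * \<beta> e e)"
    and "orthonormal_basis h' \<uu> (some_orthonormal_basis h' \<uu>)"
    and "orthonormal_basis h \<gg> (some_orthonormal_basis h \<gg>)"
proof -
  obtain BK BP where B: "orthonormal_basis h \<kk> BK" "orthonormal_basis h \<pp> BP"
    "orthonormal_basis h \<gg> (BK \<union> BP)" "BK \<inter> BP = {}"
    "\<And>y. y \<in> BK \<Longrightarrow> h y y = -1" "\<And>x. x \<in> BP \<Longrightarrow> h x x = 1"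
    by (rule standard_metric_orthonormal_bases[OF h sub]) (rule that)
  define C where "C = BK \<union> (\<lambda>x. \<i> *s x) ` BP"
  have sb': "symmetric_bilinear_on \<uu> h'" and pos': "\<And>z. z \<in> \<uu> \<Longrightarrow> z \<noteq> 0 \<Longrightarrow> h' z z > 0"
    and C: "orthonormal_basis h' \<uu> C"
    using h' B(1,2) unfolding dual_metric_def C_def by blast+
  have sb: "symmetric_bilinear_on \<gg> h" using h unfolding standard_metric_def by blast
  show some': "orthonormal_basis h' \<uu> (some_orthonormal_basis h' \<uu>)"
    unfolding some_orthonormal_basis_def by (rule someI[of "orthonormal_basis h' \<uu>", OF C])
  show some: "orthonormal_basis h \<gg> (some_orthonormal_basis h \<gg>)"
    unfolding some_orthonormal_basis_def by (rule someI[of "orthonormal_basis h \<gg>", OF B(3)])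
  \<comment> \<open>Orthonormality fixes \<open>h' e e\<close> only up to sign; positive
    definiteness decides it.\<close>
  have one: "h' e e = 1" if "e \<in> C" for e
  proof -
    have "e \<noteq> 0" using C that dependent_zero unfolding orthonormal_basis_def by blast
    then have "h' e e > 0" using pos' orthonormal_basis_subset[OF C] that by blast
    then show ?thesis using C that unfolding orthonormal_basis_def by fastforce
  qed
  have fin: "finite BK" "finite BP"
    using B(1,2) independent_imp_finite unfolding orthonormal_basis_def by blast+
  have inj: "inj_on (\<lambda>x. \<i> *s x) BP" by (rule inj_onI) (simp add: vec_eq_iff)
  \<comment> \<open>Needed to split the sum over \<open>C\<close> into its two parts;
    \<open>real\<close> would make a common vector 0, which no basis contains.\<close>
  have disj: "BK \<inter> (\<lambda>x. \<i> *s x) ` BP = {}"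
  proof (rule equals0I)
    fix y assume "y \<in> BK \<inter> (\<lambda>x. \<i> *s x) ` BP"
    then obtain x where x: "y \<in> BK" "x \<in> BP" "y = \<i> *s x" by auto
    then have "y \<in> \<kk>" "x \<in> \<pp>" using B(1,2)[THEN orthonormal_basis_subset] by auto
    then have "y = 0" using real x(3) by auto
    then show False using x(1) B(1) dependent_zero unfolding orthonormal_basis_def by auto
  qed
  have "(\<Sum>e\<in>some_orthonormal_basis h' \<uu>. of_real (h' e e) * \<beta> e e) = (\<Sum>e\<in>C. of_real (h' e e) * \<beta> e e)"
    by (rule orthonormal_trace_unique[OF sb' \<beta>(1) some' C])
  also have "\<dots> = (\<Sum>e\<in>C. \<beta> e e)" by (simp add: one)
  also have "\<dots> = (\<Sum>e\<in>BK. \<beta> e e) - (\<Sum>e\<in>BP. \<beta> e e)"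
    using sum.union_disjoint[OF fin(1) finite_imageI[OF fin(2)] disj, of "\<lambda>e. \<beta> e e"]
    unfolding C_def sum.reindex[OF inj] comp_def \<beta>(2) sum_negf by simp
  also have "\<dots> = - (\<Sum>e\<in>BK \<union> BP. of_real (h e e) * \<beta> e e)"
    using fin B(4-6) by (simp add: sum.union_disjoint sum_negf)
  also have "(\<Sum>e\<in>BK \<union> BP. of_real (h e e) * \<beta> e e) =
      (\<Sum>e\<in>some_orthonormal_basis h \<gg>. of_real (h e e) * \<beta> e e)"
    by (rule orthonormal_trace_unique[OF sb \<beta>(1) B(3) some])
  finally show "(\<Sum>e\<in>some_orthonormal_basis h' \<uu>. of_real (h' e e) * \<beta> e e) =
    - (\<Sum>e\<in>some_orthonormal_basis h \<gg>. of_real (h e e) * \<beta> e e)" .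
qed

theorem theorem7p1:
  fixes L :: "('g::{t2_space, second_countable_topology}, 'd::finite) lie_data"
    and G K U W WC :: "'g set"
    and \<pp> :: "(complex ^ 'd) set"
    and h h' :: "complex ^ 'd \<Rightarrow> complex ^ 'd \<Rightarrow> real"
    and \<E> :: "('g \<Rightarrow> complex) set"
  assumes "complexification_of L G"
    and "noncompact_semisimple L G"
    and "maximal_compact_subgroup L G K"
    and "cartan_decomposition L (lie_algebra L G) (lie_algebra L K) \<pp>"
    and "compact_dual L (lie_algebra L K) \<pp> U"
    and "standard_metric (lie_algebra L G) (lie_algebra L K) \<pp> h"
    and "dual_metric (lie_algebra L U) (lie_algebra L K) \<pp> h h'"
    and "openin (top_of_set G) W"
    and "open WC" and "W \<subseteq> WC"
    and "\<forall>C\<in>components WC. C \<inter> U \<noteq> {}"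
    and "\<forall>\<phi>\<in>\<E>. real_analytic_fun L W \<phi>"
    and "\<forall>\<phi>\<in>\<E>. \<exists>!\<psi>. is_holomorphic_extension L W WC \<phi> \<psi>"
  shows "eigenfamily L U h' (U \<inter> WC) (dual_map L U W WC ` \<E>) \<longleftrightarrow> eigenfamily L G h W \<E>"
proof -
  interpret complex_group L
    using assms(1) unfolding complexification_of_def by unfold_locales blast
  let ?\<gg> = "lie_algebra L G" and ?\<kk> = "lie_algebra L K" and ?\<uu> = "lie_algebra L U"
  note WC = \<open>open WC\<close>
  have G: "subgroup G L"
    and decomp: "\<exists>!(x, y). x \<in> ?\<gg> \<and> y \<in> ?\<gg> \<and> z = x + \<i> *s y" for z
    using assms(1) unfolding complexification_of_def by blast+
  have sub: "subspace ?\<kk>" "subspace \<pp>" "?\<gg> = {y + x | y x. y \<in> ?\<kk> \<and> x \<in> \<pp>}"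
    using assms(4) unfolding cartan_decomposition_def by blast+
  have U: "subgroup U L" and \<uu>: "?\<uu> = {y + \<i> *s x | y x. y \<in> ?\<kk> \<and> x \<in> \<pp>}"
    using assms(5) unfolding compact_dual_def by blast+
  have kg: "y \<in> ?\<gg>" if "y \<in> ?\<kk>" for y
    unfolding sub(3) using that subspace_0[OF sub(2)] by force
  have pg: "x \<in> ?\<gg>" if "x \<in> \<pp>" for x
    unfolding sub(3) using that subspace_0[OF sub(1)] by force
  \<comment> \<open>A vector common to \<kk> and \<i>\<pp> would have the two decompositions
    \<open>(y, 0)\<close> and \<open>(0, x)\<close> along \<gg> and \<i>\<gg>.\<close>
  have real: "\<forall>y\<in>?\<kk>. \<forall>x\<in>\<pp>. y = \<i> *s x \<longrightarrow> y = 0"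
  proof (intro ballI impI)
    fix y x assume that: "y \<in> ?\<kk>" "x \<in> \<pp>" "y = \<i> *s x"
    have "0 \<in> ?\<gg>" using kg subspace_0[OF sub(1)] by blast
    moreover have "y = y + \<i> *s 0" "y = 0 + \<i> *s x" using that(3) by auto
    ultimately have "(y, 0 :: complex ^ 'd) = (0, x)"
      using the1_equality[OF decomp[of y], of "(y, 0)"] the1_equality[OF decomp[of y], of "(0, x)"]
        kg[OF that(1)] pg[OF that(2)] by auto
    then show "y = 0" by simp
  qed
  have gen: "\<exists>u\<in>?\<uu>. \<exists>u'\<in>?\<uu>. z = u + \<i> *s u'" for z
  proof -
    obtain a b where "a \<in> ?\<gg>" "b \<in> ?\<gg>" and z: "z = a + \<i> *s b" using decomp[of z] by blast
    then obtain y x y' x' where k: "y \<in> ?\<kk>" "y' \<in> ?\<kk>" and p: "x \<in> \<pp>" "x' \<in> \<pp>"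
      and ab: "a = y + x" "b = y' + x'" unfolding sub(3) by blast
    \<comment> \<open>The \<pp>-parts trade places: \<open>\<i> *s x'\<close> already lies in \<uu>,
      while \<open>x\<close> is \<i> times \<open>\<i> *s (- x)\<close>.\<close>
    have "z = (y + \<i> *s x') + \<i> *s (y' + \<i> *s (- x))"
      unfolding z ab by (simp add: vec_eq_iff algebra_simps)
    moreover have "y + \<i> *s x' \<in> ?\<uu>" "y' + \<i> *s (- x) \<in> ?\<uu>"
      unfolding \<uu> using k p subspace_neg[OF sub(2)] by blast+
    ultimately show ?thesis by blast
  qed
  \<comment> \<open>\<open>W\<close> may be smaller than \<open>G \<inter> WC\<close>, whereas
    comparing derivatives requires agreement with the extension on the whole intersection of
    \<open>G\<close> with an open set; \<open>WC \<inter> O1\<close> is such a set. For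
    \<open>U\<close> the set \<open>WC\<close> itself serves.\<close>
  obtain O1 where O1: "open O1" "W = G \<inter> O1" using assms(8) unfolding openin_open by blast
  have W: "W = G \<inter> WC \<inter> O1" using O1 \<open>W \<subseteq> WC\<close> by blast

  define ext where "ext = holomorphic_extension L W WC"
  have ext_is: "is_holomorphic_extension L W WC \<phi> (ext \<phi>)"
    and ext_unique: "is_holomorphic_extension L W WC \<phi> \<psi> \<Longrightarrow> \<psi> = ext \<phi>" if "\<phi> \<in> \<E>" for \<phi> \<psi>
  proof -
    have ex1: "\<exists>!\<psi>. is_holomorphic_extension L W WC \<phi> \<psi>" using assms(13) that by blast
    show 1: "is_holomorphic_extension L W WC \<phi> (ext \<phi>)"
      unfolding ext_def holomorphic_extension_def by (rule theI'[OF ex1])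
    show "is_holomorphic_extension L W WC \<phi> \<psi> \<Longrightarrow> \<psi> = ext \<phi>" using ex1 1 by blast
  qed
  have ext_hol: "holomorphic_fun L (ext \<phi>) WC" and ext_W: "\<And>g. g \<in> W \<Longrightarrow> ext \<phi> g = \<phi> g" if "\<phi> \<in> \<E>" for \<phi>
    using ext_is[OF that] unfolding is_holomorphic_extension_def by blast+

  \<comment> \<open>The common carriers of both operators, living on all of \<open>WC\<close>: they
    restrict to the operators on \<open>W\<close>, and to their negatives on
    \<open>U \<inter> WC\<close>.\<close>
  define \<tau> where "\<tau> \<phi> g = (\<Sum>e\<in>some_orthonormal_basis h ?\<gg>.
      of_real (h e e) * left_deriv L e (left_deriv L e (ext \<phi>)) g)" for \<phi> g
  define \<kappa> where "\<kappa> \<phi> \<psi> g = (\<Sum>e\<in>some_orthonormal_basis h ?\<gg>.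
      of_real (h e e) * (left_deriv L e (ext \<phi>) g * left_deriv L e (ext \<psi>) g))" for \<phi> \<psi> g
  have \<tau>_hol: "holomorphic_fun L (\<tau> \<phi>) WC" if "\<phi> \<in> \<E>" for \<phi>
    unfolding \<tau>_def using ext_hol[OF that] WC
    by (intro holomorphic_fun_sum holomorphic_fun_mult holomorphic_fun_const left_deriv_holomorphic)
  have \<kappa>_hol: "holomorphic_fun L (\<kappa> \<phi> \<psi>) WC" if "\<phi> \<in> \<E>" "\<psi> \<in> \<E>" for \<phi> \<psi>
    unfolding \<kappa>_def using ext_hol[OF that(1)] ext_hol[OF that(2)] WC
    by (intro holomorphic_fun_sum holomorphic_fun_mult holomorphic_fun_const left_deriv_holomorphic)

  note trace = trace_dual_metric[OF assms(6) sub assms(7) real]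
  \<comment> \<open>The zero form stands in for \<open>\<beta>\<close> to extract the two facts
    about the chosen bases.\<close>
  have bilin0: "bilinear (\<lambda>u v :: complex ^ 'd. 0 :: complex)" by (simp add: bilinear_def linear_iff)
  have onb: "orthonormal_basis h' ?\<uu> (some_orthonormal_basis h' ?\<uu>)"
    "orthonormal_basis h ?\<gg> (some_orthonormal_basis h ?\<gg>)"
    by (rule trace(2,3)[OF bilin0]; simp)+
  have in_\<uu>: "e \<in> ?\<uu>" if "e \<in> some_orthonormal_basis h' ?\<uu>" for e
    using that orthonormal_basis_subset[OF onb(1)] by blast
  have in_\<gg>: "e \<in> ?\<gg>" if "e \<in> some_orthonormal_basis h ?\<gg>" for e
    using that orthonormal_basis_subset[OF onb(2)] by blast

  have W_sub: "g \<in> G \<inter> (WC \<inter> O1)" if "g \<in> W" for g using that W by blast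
  have opn: "open (WC \<inter> O1)" using WC O1(1) by blast
  have hol_sub: "holomorphic_fun L F (WC \<inter> O1)" if "holomorphic_fun L F WC" for F
    using that unfolding holomorphic_fun_def by (force intro: hol_on_subset)
  have ext_G: "\<phi> g = ext \<phi> g" if "\<phi> \<in> \<E>" "g \<in> G \<inter> (WC \<inter> O1)" for \<phi> g
    using ext_W[OF that(1)] that(2) W by auto
  have lie_deriv_G: "lie_deriv L G e \<phi> g = left_deriv L e (ext \<phi>) g"
    if "e \<in> ?\<gg>" "\<phi> \<in> \<E>" "g \<in> W" for e \<phi> g
    by (rule lie_deriv_eq_left_deriv[OF G that(1) hol_sub[OF ext_hol[OF that(2)]] opn ext_G[OF that(2)] W_sub[OF that(3)]])
  have tension_G: "tension L G h \<phi> g = \<tau> \<phi> g" if "\<phi> \<in> \<E>" "g \<in> W" for \<phi> g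
    unfolding tension_def \<tau>_def
    by (intro sum.cong refl arg_cong2[of _ _ _ _ "(*)"]
        lie_deriv2_eq_left_deriv[OF G in_\<gg> hol_sub[OF ext_hol[OF that(1)]] opn ext_G[OF that(1)] W_sub[OF that(2)]])
  have conformality_G: "conformality L G h \<phi> \<psi> g = \<kappa> \<phi> \<psi> g" if "\<phi> \<in> \<E>" "\<psi> \<in> \<E>" "g \<in> W" for \<phi> \<psi> g
  proof -
    have "lie_deriv L G e \<eta> g = left_deriv L e (ext \<eta>) g"
      if e: "e \<in> some_orthonormal_basis h ?\<gg>" and \<eta>: "\<eta> \<in> \<E>" for e \<eta>
      using lie_deriv_G[OF in_\<gg>[OF e] \<eta> \<open>g \<in> W\<close>] .
    then show ?thesis
      unfolding conformality_def \<kappa>_def using that by (intro sum.cong refl) (simp add: mult.assoc)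
  qed
  have dual: "dual_map L U W WC \<phi> g = ext \<phi> g" if "g \<in> U \<inter> WC" for \<phi> g
    using that unfolding dual_map_def ext_def by simp
  have tension_U: "tension L U h' (dual_map L U W WC \<phi>) g = - \<tau> \<phi> g" if "\<phi> \<in> \<E>" "g \<in> U \<inter> WC" for \<phi> g
  proof -
    have "tension L U h' (dual_map L U W WC \<phi>) g =
        (\<Sum>e\<in>some_orthonormal_basis h' ?\<uu>. of_real (h' e e) * left_deriv L e (left_deriv L e (ext \<phi>)) g)"
      unfolding tension_def
      by (intro sum.cong refl arg_cong2[of _ _ _ _ "(*)"]
          lie_deriv2_eq_left_deriv[OF U in_\<uu> ext_hol[OF that(1)] WC dual that(2)])
    also have "\<dots> = - \<tau> \<phi> g"
      unfolding \<tau>_def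
    proof (rule trace(1)[where \<beta> = "\<lambda>u v. left_deriv L u (left_deriv L v (ext \<phi>)) g"])
      have gWC: "g \<in> WC" using that by blast
      show "bilinear (\<lambda>u v. left_deriv L u (left_deriv L v (ext \<phi>)) g)"
        by (rule left_deriv2_bilinear[OF ext_hol[OF that(1)] WC gWC])
      show "left_deriv L (\<i> *s v) (left_deriv L (\<i> *s v) (ext \<phi>)) g =
          - left_deriv L v (left_deriv L v (ext \<phi>)) g" for v
        by (simp add: left_deriv2_scale[OF ext_hol[OF that(1)] WC gWC])
    qed
    finally show ?thesis .
  qed
  have conformality_U: "conformality L U h' (dual_map L U W WC \<phi>) (dual_map L U W WC \<psi>) g = - \<kappa> \<phi> \<psi> g"
    if "\<phi> \<in> \<E>" "\<psi> \<in> \<E>" "g \<in> U \<inter> WC" for \<phi> \<psi> g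
  proof -
    have "conformality L U h' (dual_map L U W WC \<phi>) (dual_map L U W WC \<psi>) g =
        (\<Sum>e\<in>some_orthonormal_basis h' ?\<uu>. of_real (h' e e) *
          (left_deriv L e (ext \<phi>) g * left_deriv L e (ext \<psi>) g))"
      unfolding conformality_def mult.assoc
      by (intro sum.cong refl arg_cong2[of _ _ _ _ "(*)"]
          lie_deriv_eq_left_deriv[OF U in_\<uu> ext_hol[OF that(1)] WC dual that(3)]
          lie_deriv_eq_left_deriv[OF U in_\<uu> ext_hol[OF that(2)] WC dual that(3)])
    also have "\<dots> = - \<kappa> \<phi> \<psi> g"
      unfolding \<kappa>_def
    proof (rule trace(1)[where \<beta> = "\<lambda>u v. left_deriv L u (ext \<phi>) g * left_deriv L v (ext \<psi>) g"])
      have gWC: "g \<in> WC" using that by blast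
      show "bilinear (\<lambda>u v. left_deriv L u (ext \<phi>) g * left_deriv L v (ext \<psi>) g)"
        by (rule left_deriv_prod_bilinear[OF ext_hol[OF that(1)] ext_hol[OF that(2)] WC gWC])
      show "left_deriv L (\<i> *s v) (ext \<phi>) g * left_deriv L (\<i> *s v) (ext \<psi>) g =
          - (left_deriv L v (ext \<phi>) g * left_deriv L v (ext \<psi>) g)" for v
        by (simp add: left_translate_hol(2)[OF ext_hol[OF that(1)] WC gWC]
            left_translate_hol(2)[OF ext_hol[OF that(2)] WC gWC]) (simp add: complex_eq_iff algebra_simps)
    qed
    finally show ?thesis .
  qed

  \<comment> \<open>Transfer of holomorphic identities between \<open>W\<close> and
    \<open>U \<inter> WC\<close>\<close>
  have zero_from_W: "F g = 0"
    if "\<phi> \<in> \<E>" and F: "holomorphic_fun L F WC" "\<And>g. g \<in> W \<Longrightarrow> F g = 0" and g: "g \<in> WC" for F \<phi> g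
  proof -
    \<comment> \<open>\<open>ext \<phi> + F\<close> is a second extension of \<open>\<phi>\<close>, so uniqueness replaces the identity theorem here.\<close>
    have "holomorphic_fun L (restrict (\<lambda>x. ext \<phi> x + F x) WC) WC"
      by (rule holomorphic_fun_cong[OF holomorphic_fun_add[OF ext_hol[OF that(1)] F(1)] WC]) simp
    then have "is_holomorphic_extension L W WC \<phi> (restrict (\<lambda>x. ext \<phi> x + F x) WC)"
      unfolding is_holomorphic_extension_def
      using ext_W[OF that(1)] F(2) \<open>W \<subseteq> WC\<close> by (auto simp: subset_iff)
    from fun_cong[OF ext_unique[OF that(1) this], of g] show ?thesis using g by simp
  qed
  \<comment> \<open>\<open>\<phi>\<close> appears because uniqueness of extensions is a hypothesis
    on members of \<open>\<E>\<close>; a single member suffices for arbitrary \<open>F\<close> and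
    \<open>F'\<close>.\<close>
  have zero_iff: "(\<forall>g\<in>U \<inter> WC. F g = F' g) \<longleftrightarrow> (\<forall>g\<in>W. F g = F' g)"
    if "\<phi> \<in> \<E>" and F: "holomorphic_fun L F WC" "holomorphic_fun L F' WC" for F F' \<phi>
  proof -
    have hol: "holomorphic_fun L (\<lambda>g. F g + (-1) * F' g) WC"
      by (intro holomorphic_fun_add holomorphic_fun_mult holomorphic_fun_const F)
    show ?thesis
    proof
      assume "\<forall>g\<in>U \<inter> WC. F g = F' g"
      then have "F g + (-1) * F' g = 0" if "g \<in> WC" for g
        using vanishing_on_totally_real_subgroup[OF hol WC U gen assms(11) _ that] by simp
      then show "\<forall>g\<in>W. F g = F' g" using \<open>W \<subseteq> WC\<close> by auto
    next
      assume "\<forall>g\<in>W. F g = F' g"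
      then have "F g + (-1) * F' g = 0" if "g \<in> WC" for g
        using zero_from_W[OF \<open>\<phi> \<in> \<E>\<close> hol _ that] by simp
      then show "\<forall>g\<in>U \<inter> WC. F g = F' g" by auto
    qed
  qed

  \<comment> \<open>For fixed \<open>lam\<close> and \<open>\<mu>\<close> both sides of each
    equation are holomorphic on \<open>WC\<close>, so it transfers with the same constants; the
    change of sign is a separate link of the chain below.\<close>
  have iff: "(\<forall>g\<in>U \<inter> WC. \<tau> \<phi> g = lam * ext \<phi> g \<and> \<kappa> \<phi> \<psi> g = \<mu> * ext \<phi> g * ext \<psi> g) \<longleftrightarrow>
      (\<forall>g\<in>W. \<tau> \<phi> g = lam * ext \<phi> g \<and> \<kappa> \<phi> \<psi> g = \<mu> * ext \<phi> g * ext \<psi> g)"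
    if "\<phi> \<in> \<E>" "\<psi> \<in> \<E>" for \<phi> \<psi> lam \<mu>
  proof -
    have "(\<forall>g\<in>U \<inter> WC. \<tau> \<phi> g = lam * ext \<phi> g) \<longleftrightarrow> (\<forall>g\<in>W. \<tau> \<phi> g = lam * ext \<phi> g)"
      by (intro zero_iff[OF that(1)] \<tau>_hol that holomorphic_fun_mult holomorphic_fun_const ext_hol)
    moreover have "(\<forall>g\<in>U \<inter> WC. \<kappa> \<phi> \<psi> g = \<mu> * ext \<phi> g * ext \<psi> g) \<longleftrightarrow>
        (\<forall>g\<in>W. \<kappa> \<phi> \<psi> g = \<mu> * ext \<phi> g * ext \<psi> g)"
      by (intro zero_iff[OF that(1)] \<kappa>_hol that holomorphic_fun_mult holomorphic_fun_const ext_hol)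
    ultimately show ?thesis by blast
  qed
  have "eigenfamily L U h' (U \<inter> WC) (dual_map L U W WC ` \<E>) \<longleftrightarrow>
      (\<exists>lam \<mu>. \<forall>\<phi>\<in>\<E>. \<forall>\<psi>\<in>\<E>. \<forall>g\<in>U \<inter> WC.
        - \<tau> \<phi> g = lam * ext \<phi> g \<and> - \<kappa> \<phi> \<psi> g = \<mu> * ext \<phi> g * ext \<psi> g)"
    unfolding eigenfamily_def by (simp add: tension_U conformality_U dual del: Int_iff cong: ball_cong)
  also have "\<dots> \<longleftrightarrow> (\<exists>lam \<mu>. \<forall>\<phi>\<in>\<E>. \<forall>\<psi>\<in>\<E>. \<forall>g\<in>U \<inter> WC.
        \<tau> \<phi> g = lam * ext \<phi> g \<and> \<kappa> \<phi> \<psi> g = \<mu> * ext \<phi> g * ext \<psi> g)"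
    (is "?A \<longleftrightarrow> ?B")
  proof
    assume ?A
    then obtain lam \<mu> where *: "\<And>\<phi> \<psi> g. \<phi> \<in> \<E> \<Longrightarrow> \<psi> \<in> \<E> \<Longrightarrow> g \<in> U \<inter> WC \<Longrightarrow>
        - \<tau> \<phi> g = lam * ext \<phi> g \<and> - \<kappa> \<phi> \<psi> g = \<mu> * ext \<phi> g * ext \<psi> g" by blast
    have "\<tau> \<phi> g = - lam * ext \<phi> g \<and> \<kappa> \<phi> \<psi> g = - \<mu> * ext \<phi> g * ext \<psi> g"
      if "\<phi> \<in> \<E>" "\<psi> \<in> \<E>" "g \<in> U \<inter> WC" for \<phi> \<psi> g
      using arg_cong[OF conjunct1[OF *[OF that]], of uminus]
        arg_cong[OF conjunct2[OF *[OF that]], of uminus] by simp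
    then show ?B by blast
  next
    assume ?B
    then obtain lam \<mu> where "\<And>\<phi> \<psi> g. \<phi> \<in> \<E> \<Longrightarrow> \<psi> \<in> \<E> \<Longrightarrow> g \<in> U \<inter> WC \<Longrightarrow>
        \<tau> \<phi> g = lam * ext \<phi> g \<and> \<kappa> \<phi> \<psi> g = \<mu> * ext \<phi> g * ext \<psi> g" by blast
    then show ?A by (intro exI[of _ "- lam"] exI[of _ "- \<mu>"]) simp
  qed
  also have "\<dots> \<longleftrightarrow> (\<exists>lam \<mu>. \<forall>\<phi>\<in>\<E>. \<forall>\<psi>\<in>\<E>. \<forall>g\<in>W.
        \<tau> \<phi> g = lam * ext \<phi> g \<and> \<kappa> \<phi> \<psi> g = \<mu> * ext \<phi> g * ext \<psi> g)"
    by (intro arg_cong[of _ _ Ex] ext ball_cong refl iff)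
  also have "\<dots> \<longleftrightarrow> eigenfamily L G h W \<E>"
    unfolding eigenfamily_def by (simp add: tension_G conformality_G ext_W cong: ball_cong)
  finally show ?thesis .
qed

end
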